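(* For every $k\in\mathbb{N}$ and all countable ordinals $\alpha_0,\dots,\alpha_{k-1}$, $$\operatorname{Ram}(\alpha_0,\dots,\alpha_{k-1})^1_k=\alpha_0\,\#\,\cdots\,\#\,\alpha_{k-1}.$$
   Context: $\#$ is the natural (Hessenberg) sum of ordinals. Finite subsets of $\mathbb{N}$ are identified with strictly increasing sequences; $\sqsubseteq$/$\sqsubset$ (proper) initial segment; $s^\frown t$ concatenation. A set $\mathcal{B}\subseteq[\mathbb{N}]^{<\omega}$ is a front if either $\mathcal{B}=\{\langle\rangle\}$ (degenerate, base $\mathbb{N}$) or: (1) $\operatorname{base}(\mathcal{B})=\bigcup\mathcal{B}$ is infinite; (2) every infinite $X\subseteq\operatorname{base}(\mathcal{B})$ has $s\in\mathcal{B}$ with $s\sqsubset X$; (3) no $s,t\in\mathcal{B}$ with $s\sqsubset t$. Barrier: front with no $s\subsetneq t$ in it. Smooth: for $s,t\in\mathcal{B}$ with $|s|<|t|$ some $i<|s|$ has $s(i)<t(i)$. $T(\mathcal{B})$: finite subsets of the base with no proper initial segment in $\mathcal{B}$; $\operatorname{ht}_{\mathcal{B}}$ its rank ($0$ on $\mathcal{B}$, else $\sup(\operatorname{ht}_{\mathcal{B}}(s^\frown\langle n\rangle)+1)$), $\operatorname{ht}(\mathcal{B})=\operatorname{ht}_{\mathcal{B}}(\langle\rangle)$. $Y$ is a final segment of $X$ if $Y=\{n\in X:n\ge m\}$ for some $m$; if $\operatorname{base}(\mathcal{B})$ is a final segment of $\operatorname{base}(\mathcal{A})$, $\mathcal{A}\oplus\mathcal{B}=\{s^\frown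 t:s\in\mathcal{B},t\in\mathcal{A},\max s<\min t\}$. A smooth barrier of height $\omega^{\beta_0}+\dots+\omega^{\beta_{n-1}}$ (CNF) is decomposable if it equals $\mathcal{B}_0\oplus\dots\oplus\mathcal{B}_{n-1}$ with smooth barriers $\operatorname{ht}(\mathcal{B}_i)=\omega^{\beta_i}$; SD-barrier = smooth decomposable barrier (degenerate front counts). $t$ is $\mathcal{C}$-size if $t\in\mathcal{C}$; $[s]^{\mathcal{C}}=\{u\in\mathcal{C}:u\subseteq s\}$; $\mathbb{1}$ is the barrier of singletons on the relevant base. For fronts $\mathcal{A}_0,\dots,\mathcal{A}_{k-1},\mathcal{B},\mathcal{C}$ with $\operatorname{base}(\mathcal{B})=\bigcap_i\operatorname{base}(\mathcal{A}_i)$ and each $\operatorname{base}(\mathcal{A}_i)$ a final segment of $\operatorname{base}(\mathcal{C})$, $\mathcal{B}\to(\mathcal{A}_0,\dots,\mathcal{A}_{k-1})^{\mathcal{C}}_k$ means: for every $(\mathbb{1}\oplus\mathcal{B})$-size $s$ and every $c:[s]^{\mathcal{C}}\to\{0,\dots,k-1\}$ there are $i<k$ and a $(\mathcal{C}\oplus\mathcal{A}_i)$-size $t\subseteq s$ with $c(u)=i$ for all $u\in[t]^{\mathcal{C}}$. For countable ordinals $\alpha_0,\dots,\alpha_{k-1},\gamma$, $\operatorname{Ram}(\alpha_0,\dots,\alpha_{k-1})^\gamma_k$ is the least $\beta$ such that for all SD-barriers $\mathcal{A}_0,\dots,\mathcal{A}_{k-1},\mathcal{C}$ with $\operatorname{ht}(\mathcal{A}_i)=\alpha_i$,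 $\operatorname{ht}(\mathcal{C})=\gamma$, each $\operatorname{base}(\mathcal{A}_i)$ a final segment of $\operatorname{base}(\mathcal{C})$, there is an SD-barrier $\mathcal{B}$ with $\operatorname{ht}(\mathcal{B})=\beta$, $\operatorname{base}(\mathcal{B})=\bigcap_i\operatorname{base}(\mathcal{A}_i)$ and $\mathcal{B}\to(\mathcal{A}_0,\dots,\mathcal{A}_{k-1})^{\mathcal{C}}_k$. *)

theory Defs
  imports Main "HOL-Library.Countable_Set"
begin

section \<open>Countable ordinals\<close>

text \<open>
  The countable ordinals are the elements of the first uncountable cardinal \<open>\<omega>\<^sub>1\<close>, which the
  BNF cardinal library provides as the well-order \<^term>\<open>cardSuc natLeq\<close>: every proper initial
  segment of it is countable, and every countable subset is bounded (proved below).
\<close>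

typedef cord = "Field (cardSuc natLeq)"
  using Field_cardSuc_not_empty[OF natLeq_Card_order] by blast

instantiation cord :: wellorder
begin

definition less_eq_cord :: "cord \<Rightarrow> cord \<Rightarrow> bool" where
  "a \<le> b \<longleftrightarrow> (Rep_cord a, Rep_cord b) \<in> cardSuc natLeq"

definition less_cord :: "cord \<Rightarrow> cord \<Rightarrow> bool" where
  "(a :: cord) < b \<longleftrightarrow> a \<le> b \<and> a \<noteq> b"

instance
proof -
  let ?r = "cardSuc natLeq"
  have wo: "well_order_on (Field ?r) ?r"
    using cardSuc_Well_order[OF natLeq_Card_order] .
  then have refl: "\<And>x. x \<in> Field ?r \<Longrightarrow> (x, x) \<in> ?r"
    and tr: "trans ?r" and anti: "antisym ?r" and tot: "total_on (Field ?r) ?r"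
    and wf: "wf (?r - Id)"
    unfolding well_order_on_def linear_order_on_def partial_order_on_def preorder_on_def refl_on_def
    by auto
  show "OFCLASS(cord, wellorder_class)"
  proof (standard, goal_cases)
    case (1 x y)
    then show ?case using antisymD[OF anti, of "Rep_cord x" "Rep_cord y"]
      by (auto simp: less_cord_def less_eq_cord_def Rep_cord_inject)
  next
    case (2 x)
    then show ?case using refl[OF Rep_cord] unfolding less_eq_cord_def .
  next
    case (3 x y z)
    then show ?case using transD[OF tr] unfolding less_eq_cord_def by blast
  next
    case (4 x y)
    then show ?case using antisymD[OF anti, of "Rep_cord x" "Rep_cord y"]
      by (simp add: less_eq_cord_def Rep_cord_inject)
  next
    case (5 x y)
    then show ?case using tot refl[OF Rep_cord[of x]] Rep_cord[of x] Rep_cord[of y]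
      unfolding less_eq_cord_def total_on_def by (cases "x = y") (auto simp: Rep_cord_inject)
  next
    case (6 P a)
    have "wf {(x :: cord, y). x < y}"
      by (rule wf_subset[OF wf_inv_image[OF wf, of Rep_cord]])
        (auto simp: less_cord_def less_eq_cord_def Rep_cord_inject)
    then show ?case by (induction a rule: wf_induct_rule) (use 6 in auto)
  qed
qed

end

lemma countable_card_of_le:
  assumes "countable A"
  shows "(card_of A, natLeq) \<in> ordLeq"
proof -
  from assms have "(card_of A, card_of (UNIV :: nat set)) \<in> ordLeq"
    unfolding countable_def card_of_ordLeq[symmetric] by simp
  then show ?thesis using card_of_nat by (rule ordLeq_ordIso_trans)
qed

lemma countable_lessThan_cord: "countable {..<a :: cord}"
proof -
  let ?r = "cardSuc natLeq"
  have sub: "Rep_cord ` {..<a} \<subseteq> underS ?r (Rep_cord a)"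
    by (auto simp: underS_def less_cord_def less_eq_cord_def Rep_cord_inject)
  have "(card_of (underS ?r (Rep_cord a)), ?r) \<in> ordLess"
    by (rule card_of_underS[OF cardSuc_Card_order[OF natLeq_Card_order] Rep_cord])
  then have "(card_of (underS ?r (Rep_cord a)), natLeq) \<in> ordLeq"
    using cardSuc_ordLeq_ordLess[OF natLeq_Card_order card_of_Card_order] by blast
  then have "(card_of (underS ?r (Rep_cord a)), card_of (UNIV :: nat set)) \<in> ordLeq"
    using card_of_nat ordIso_symmetric ordLeq_ordIso_trans by blast
  then have "countable (underS ?r (Rep_cord a))"
    unfolding card_of_ordLeq[symmetric] countable_def by auto
  then have "countable (Rep_cord ` {..<a})" using sub countable_subset by blast
  then show ?thesis by (rule countable_image_inj_on) (auto simp: inj_on_def Rep_cord_inject)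
qed

lemma countable_bounded_cord:
  assumes "countable (A :: cord set)"
  shows "\<exists>b. \<forall>a\<in>A. a < b"
proof (rule ccontr)
  let ?r = "cardSuc natLeq"
  assume neg: "\<not> ?thesis"
  have Cinf: "Cinfinite natLeq" by (rule natLeq_Cinfinite)
  have "cofinal (Rep_cord ` A) ?r"
    unfolding cofinal_def
  proof
    fix x assume "x \<in> Field ?r"
    then obtain y where y: "x = Rep_cord y" by (metis Rep_cord_cases)
    have lim: "\<exists>z. y < z"
    proof (rule ccontr)
      assume "\<not> ?thesis"
      then have "(UNIV :: cord set) \<subseteq> insert y {..<y}"
        by (metis UNIV_I insertCI lessThan_iff linorder_less_linear subsetI)
      then have "countable (UNIV :: cord set)"
        using countable_lessThan_cord by (meson countable_insert countable_subset)
      then have "countable (range Rep_cord)" by simp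
      then have "countable (Field ?r)"
        by (simp add: type_definition.Rep_range[OF type_definition_cord])
      then have "(card_of (Field ?r), natLeq) \<in> ordLeq"
        by (rule countable_card_of_le)
      then have "(?r, natLeq) \<in> ordLeq"
        using card_of_Field_ordIso[OF cardSuc_Card_order[OF natLeq_Card_order]]
          ordIso_symmetric ordIso_ordLeq_trans by blast
      then show False
        using cardSuc_greater[OF natLeq_Card_order] not_ordLess_ordLeq by blast
    qed
    then obtain z where "y < z" by blast
    from neg obtain a where "a \<in> A" "\<not> a < z" by blast
    with \<open>y < z\<close> have "y < a" by auto
    with \<open>a \<in> A\<close> show "\<exists>b\<in>Rep_cord ` A. x \<noteq> b \<and> (x, b) \<in> ?r"
      by (intro bexI[of _ "Rep_cord a"])
        (auto simp: y less_cord_def less_eq_cord_def Rep_cord_inject)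
  qed
  moreover have "Rep_cord ` A \<subseteq> Field ?r" using Rep_cord by auto
  ultimately have iso: "(card_of (Rep_cord ` A), ?r) \<in> ordIso"
    using regularCard_cardSuc[OF Cinf] unfolding regularCard_def by blast
  have "countable (Rep_cord ` A)" using assms by simp
  then have "(card_of (Rep_cord ` A), natLeq) \<in> ordLeq"
    by (rule countable_card_of_le)
  then have "(?r, natLeq) \<in> ordLeq"
    using iso ordIso_symmetric ordIso_ordLeq_trans by blast
  then show False
    using cardSuc_greater[OF natLeq_Card_order] not_ordLess_ordLeq by blast
qed

text \<open>\<^term>\<open>Sup\<close> is the supremum of bounded (in particular, of countable) sets; the supremum of the
  empty set is the least ordinal.\<close>

instantiation cord :: conditionally_complete_linorder
begin

definition inf_cord :: "cord \<Rightarrow> cord \<Rightarrow> cord" where "inf_cord = min"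
definition sup_cord :: "cord \<Rightarrow> cord \<Rightarrow> cord" where "sup_cord = max"
definition Inf_cord :: "cord set \<Rightarrow> cord" where "Inf (A :: cord set) = (LEAST b. b \<in> A)"
definition Sup_cord :: "cord set \<Rightarrow> cord" where "Sup (A :: cord set) = (LEAST b. \<forall>a\<in>A. a \<le> b)"

instance
proof
  fix x z :: cord and X :: "cord set"
  show "x \<in> X \<Longrightarrow> bdd_below X \<Longrightarrow> Inf X \<le> x"
    unfolding Inf_cord_def by (rule Least_le)
  show "X \<noteq> {} \<Longrightarrow> (\<And>x. x \<in> X \<Longrightarrow> z \<le> x) \<Longrightarrow> z \<le> Inf X"
    unfolding Inf_cord_def using LeastI_ex[of "\<lambda>b. b \<in> X"] by blast
  show "x \<in> X \<Longrightarrow> bdd_above X \<Longrightarrow> x \<le> Sup X"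
    unfolding Sup_cord_def bdd_above_def
    by (erule exE, drule LeastI) blast
  show "X \<noteq> {} \<Longrightarrow> (\<And>x. x \<in> X \<Longrightarrow> x \<le> z) \<Longrightarrow> Sup X \<le> z"
    unfolding Sup_cord_def by (rule Least_le) blast
qed (auto simp: inf_cord_def sup_cord_def)

end

definition osuc :: "cord \<Rightarrow> cord" where
  "osuc a = (LEAST b. a < b)"

instantiation cord :: "{zero, one}"
begin

definition zero_cord :: cord where "0 = (LEAST a :: cord. True)"
definition one_cord :: cord where "1 = osuc 0"

instance ..

end

definition omega :: cord where
  "omega = (SUP n :: nat. (osuc ^^ n) 0)"

text \<open>
  The usual transfinite recursions for \<open>a + b\<close>, \<open>a * b\<close> and \<open>\<omega>\<^sup>b\<close>, with the zero,
  successor and limit clauses merged into one supremum.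
\<close>

declare image_cong [fundef_cong]

function oadd :: "cord \<Rightarrow> cord \<Rightarrow> cord" where
  "oadd a b = Sup (insert a ((\<lambda>d. osuc (oadd a d)) ` {..<b}))"
  by auto
termination by (relation "inv_image {(x, y). x < y} snd") (rule wf_inv_image, rule wf, simp)

declare oadd.simps [simp del]

instantiation cord :: plus
begin
definition plus_cord :: "cord \<Rightarrow> cord \<Rightarrow> cord" where "plus_cord = oadd"
instance ..
end

function omult :: "cord \<Rightarrow> cord \<Rightarrow> cord" where
  "omult a b = Sup ((\<lambda>d. omult a d + a) ` {..<b})"
  by auto
termination by (relation "inv_image {(x, y). x < y} snd") (rule wf_inv_image, rule wf, simp)

declare omult.simps [simp del]

instantiation cord :: times
begin
definition times_cord :: "cord \<Rightarrow> cord \<Rightarrow> cord" where "times_cord = omult"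
instance ..
end

function omega_pow :: "cord \<Rightarrow> cord" where
  "omega_pow b = Sup (insert 1 ((\<lambda>d. omega_pow d * omega) ` {..<b}))"
  by auto
termination by (relation "{(x, y). x < y}") (rule wf, simp)

declare omega_pow.simps [simp del]

declare image_cong [fundef_cong del]

text \<open>Cantor normal form \<open>\<omega>\<^bsup>b\<^sub>0\<^esup> + \<dots> + \<omega>\<^bsup>b\<^sub>n\<^sub>-\<^sub>1\<^esup>\<close> with \<open>b\<^sub>0 \<ge> \<dots> \<ge> b\<^sub>n\<^sub>-\<^sub>1\<close>, given by
  the list of its exponents.\<close>

definition cnf_value :: "cord list \<Rightarrow> cord" where
  "cnf_value bs = foldr (\<lambda>b a. omega_pow b + a) bs 0"

definition is_cnf :: "cord \<Rightarrow> cord list \<Rightarrow> bool" where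
  "is_cnf a bs \<longleftrightarrow> sorted_wrt (\<ge>) bs \<and> a = cnf_value bs"

text \<open>Natural (Hessenberg) sum: add Cantor normal forms as if they were polynomials in \<open>\<omega>\<close>,
  that is, merge the two exponent lists in decreasing order.\<close>

definition hsum :: "cord \<Rightarrow> cord \<Rightarrow> cord" (infixl "\<sharp>" 65) where
  "a \<sharp> b = (THE c. \<exists>as bs. is_cnf a as \<and> is_cnf b bs \<and> c = cnf_value (rev (sort (as @ bs))))"

definition hsum_list :: "cord list \<Rightarrow> cord" where
  "hsum_list as = foldl (\<sharp>) 0 as"


section \<open>Fronts and barriers\<close>

text \<open>Finite strictly increasing sequences of naturals are identified with their ranges.  The
  second argument of \<open>init_seg\<close> may be infinite.\<close>

definition init_seg :: "nat set \<Rightarrow> nat set \<Rightarrow> bool" where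
  "init_seg s t \<longleftrightarrow> s \<subseteq> t \<and> (\<forall>x\<in>s. \<forall>y\<in>t - s. x < y)"

definition pinit_seg :: "nat set \<Rightarrow> nat set \<Rightarrow> bool" where
  "pinit_seg s t \<longleftrightarrow> init_seg s t \<and> s \<noteq> t"

definition base :: "nat set set \<Rightarrow> nat set" where
  "base B = (if B = {{}} then UNIV else \<Union>B)"

definition front :: "nat set set \<Rightarrow> bool" where
  "front B \<longleftrightarrow> (\<forall>s\<in>B. finite s) \<and>
     (B = {{}} \<or>
      infinite (base B) \<and>
      (\<forall>X. infinite X \<and> X \<subseteq> base B \<longrightarrow> (\<exists>s\<in>B. pinit_seg s X)) \<and>
      \<not> (\<exists>s\<in>B. \<exists>t\<in>B. pinit_seg s t))"

definition barrier :: "nat set set \<Rightarrow> bool" where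
  "barrier B \<longleftrightarrow> front B \<and> \<not> (\<exists>s\<in>B. \<exists>t\<in>B. s \<subset> t)"

definition smooth :: "nat set set \<Rightarrow> bool" where
  "smooth B \<longleftrightarrow> (\<forall>s\<in>B. \<forall>t\<in>B. card s < card t \<longrightarrow>
     (\<exists>i < card s. sorted_list_of_set s ! i < sorted_list_of_set t ! i))"

definition smooth_barrier :: "nat set set \<Rightarrow> bool" where
  "smooth_barrier B \<longleftrightarrow> barrier B \<and> smooth B"

definition front_tree :: "nat set set \<Rightarrow> nat set set" where
  "front_tree B = {s. finite s \<and> s \<subseteq> base B \<and> \<not> (\<exists>u\<in>B. pinit_seg u s)}"

definition tree_child :: "nat set set \<Rightarrow> (nat set \<times> nat set) set" where
  "tree_child B = {(t, s). s \<in> front_tree B \<and> t \<in> front_tree B \<and>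
     (\<exists>n. (\<forall>x\<in>s. x < n) \<and> t = insert n s)}"

text \<open>For a front, \<open>tree_child B\<close> is well-founded, so that \<open>ht_at\<close> satisfies its recursion
  equation; see \<open>ht_at_rec\<close>.\<close>

definition ht_at :: "nat set set \<Rightarrow> nat set \<Rightarrow> cord" where
  "ht_at B = wfrec (tree_child B)
     (\<lambda>h s. if s \<in> B then 0 else Sup {osuc (h t) | t. (t, s) \<in> tree_child B})"

definition ht :: "nat set set \<Rightarrow> cord" where
  "ht B = ht_at B {}"

lemma wf_tree_child:
  assumes "front B"
  shows "wf (tree_child B)"
proof (rule ccontr)
  assume "\<not> ?thesis"
  then obtain f where f: "\<And>i. (f (Suc i), f i) \<in> tree_child B"
    unfolding wf_iff_no_infinite_down_chain by blast
  have "\<exists>n. (\<forall>x\<in>f i. x < n) \<and> f (Suc i) = insert n (f i)" for i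
    using f[of i] unfolding tree_child_def by simp
  then obtain m where m: "\<And>i x. x \<in> f i \<Longrightarrow> x < m i" "\<And>i. f (Suc i) = insert (m i) (f i)"
    by metis
  have ft: "f i \<in> front_tree B" for i using f[of i] unfolding tree_child_def by auto
  have mono: "i \<le> j \<Longrightarrow> init_seg (f i) (f j)" for i j
  proof (induction j rule: dec_induct)
    case base then show ?case by (auto simp: init_seg_def)
  next
    case (step j)
    have "x < m j" if "x \<in> f i" for x using that step m(1) unfolding init_seg_def by blast
    then show ?case using step(3) m(2)[of j] unfolding init_seg_def by auto
  qed
  let ?X = "\<Union>i. f i"
  have lt: "i < j \<Longrightarrow> m i < m j" for i j
  proof -
    assume "i < j"
    then have "m i \<in> f j" using m(2)[of i] mono[of "Suc i" j] unfolding init_seg_def by auto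
    then show ?thesis by (rule m(1))
  qed
  have "m i \<in> f (Suc i)" for i using m(2)[of i] by simp
  then have "range m \<subseteq> ?X" by blast
  moreover have "infinite (range m)"
    by (intro range_inj_infinite strict_mono_imp_inj_on strict_monoI lt)
  ultimately have inf: "infinite ?X" using finite_subset by blast
  have sub: "?X \<subseteq> base B" using ft unfolding front_tree_def by blast
  obtain s where s: "s \<in> B" "pinit_seg s ?X" and fin: "finite s"
  proof (cases "B = {{}}")
    case True
    moreover have "?X \<noteq> {}" using inf by (metis finite.emptyI)
    ultimately show ?thesis by (intro that[of "{}"]) (simp_all add: pinit_seg_def init_seg_def)
  next
    case False
    with assms have "\<forall>X. infinite X \<and> X \<subseteq> base B \<longrightarrow> (\<exists>s\<in>B. pinit_seg s X)"
      and "\<forall>s\<in>B. finite s"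
      unfolding front_def by simp_all
    with inf sub that show ?thesis by metis
  qed
  have fin_sub: "finite u \<Longrightarrow> u \<subseteq> ?X \<Longrightarrow> \<exists>i. u \<subseteq> f i" for u
  proof (induction u rule: finite_induct)
    case empty
    show ?case by blast
  next
    case (insert x u)
    then obtain i where i: "u \<subseteq> f i" by auto
    obtain j where j: "x \<in> f j" using insert.prems by blast
    have "f i \<subseteq> f (max i j)"
      using mono[of i "max i j"] unfolding init_seg_def by (metis max.cobounded1)
    moreover have "f j \<subseteq> f (max i j)"
      using mono[of j "max i j"] unfolding init_seg_def by (metis max.cobounded2)
    ultimately have "insert x u \<subseteq> f (max i j)" using i j by blast
    then show ?case by blast
  qed
  have sX: "s \<subseteq> ?X" and sy: "\<And>x y. x \<in> s \<Longrightarrow> y \<in> ?X \<Longrightarrow> y \<notin> s \<Longrightarrow> x < y"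
    using s(2) unfolding pinit_seg_def init_seg_def by auto
  from fin_sub[OF fin sX] obtain i where "s \<subseteq> f i" by (rule exE)
  then have "s \<subseteq> f (Suc i)" "s \<noteq> f (Suc i)" using m(1)[of "m i" i] m(2)[of i] by auto
  moreover have "x < y" if "x \<in> s" "y \<in> f (Suc i) - s" for x y
    using sy[of x y] that by auto
  ultimately have "pinit_seg s (f (Suc i))" unfolding pinit_seg_def init_seg_def by simp
  then show False using ft[of "Suc i"] s(1) unfolding front_tree_def by blast
qed

lemma ht_at_rec:
  assumes "front B"
  shows "ht_at B s =
    (if s \<in> B then 0 else Sup {osuc (ht_at B t) | t. (t, s) \<in> tree_child B})"
proof -
  have "{osuc (cut (ht_at B) (tree_child B) s t) | t. (t, s) \<in> tree_child B} =
    {osuc (ht_at B t) | t. (t, s) \<in> tree_child B}"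
    by (intro Collect_cong ex_cong1) (auto simp: cut_apply)
  then show ?thesis
    using def_wfrec[OF ht_at_def[THEN eq_reflection] wf_tree_child[OF assms], of s]
    by (simp only:)
qed

definition final_segment :: "nat set \<Rightarrow> nat set \<Rightarrow> bool" where
  "final_segment Y X \<longleftrightarrow> (\<exists>m. Y = {n \<in> X. m \<le> n})"

text \<open>Note the order: in \<open>A \<oplus> B\<close> the part from \<open>B\<close> comes first.  The operation is meant for the
  case that \<open>base B\<close> is a final segment of \<open>base A\<close>.\<close>

definition front_sum :: "nat set set \<Rightarrow> nat set set \<Rightarrow> nat set set" (infixr "\<oplus>" 65) where
  "A \<oplus> B = {s \<union> t | s t. s \<in> B \<and> t \<in> A \<and> (\<forall>x\<in>s. \<forall>y\<in>t. x < y)}"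

text \<open>The condition on consecutive bases makes every parenthesization of the iterated sum
  meaningful.  The empty sum is the degenerate front, which is neutral for \<open>\<oplus>\<close>.\<close>

definition decomposable :: "nat set set \<Rightarrow> bool" where
  "decomposable B \<longleftrightarrow> (\<exists>bs Bs.
     is_cnf (ht B) bs \<and> length Bs = length bs \<and>
     (\<forall>i < length Bs. smooth_barrier (Bs ! i) \<and> ht (Bs ! i) = omega_pow (bs ! i)) \<and>
     (\<forall>i. Suc i < length Bs \<longrightarrow> final_segment (base (Bs ! Suc i)) (base (Bs ! i))) \<and>
     B = foldr (\<oplus>) Bs {{}})"

definition sd_barrier :: "nat set set \<Rightarrow> bool" where
  "sd_barrier B \<longleftrightarrow> smooth_barrier B \<and> decomposable B"


section \<open>The Ramsey ordinals\<close>

definition singletons :: "nat set \<Rightarrow> nat set set" where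
  "singletons X = {{n} | n. n \<in> X}"

definition size_subsets :: "nat set \<Rightarrow> nat set set \<Rightarrow> nat set set" where
  "size_subsets s C = {u \<in> C. u \<subseteq> s}"

text \<open>
  The arrow \<open>B \<rightarrow> (A\<^sub>0, \<dots>, A\<^sub>k\<^sub>-\<^sub>1)\<^sup>C\<^sub>k\<close>.  The singletons are taken on the base of \<open>C\<close>.  If \<open>k > 0\<close>,
  then \<open>base B\<close> is a final segment of \<open>base C\<close>, and singletons on \<open>base B\<close> would give
  the same sum with \<open>B\<close>; if \<open>k = 0\<close>, the base of \<open>C\<close> is the only one available.
\<close>

definition arrow :: "nat set set \<Rightarrow> (nat \<Rightarrow> nat set set) \<Rightarrow> nat \<Rightarrow> nat set set \<Rightarrow> bool" where
  "arrow B A k C \<longleftrightarrow>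
     (\<forall>s \<in> singletons (base C) \<oplus> B. \<forall>c :: nat set \<Rightarrow> nat.
        c ` size_subsets s C \<subseteq> {..<k} \<longrightarrow>
        (\<exists>i<k. \<exists>t \<in> C \<oplus> A i. t \<subseteq> s \<and> (\<forall>u \<in> size_subsets t C. c u = i)))"

text \<open>For \<open>k = 0\<close> the intersection of the bases is the whole of \<^term>\<open>UNIV :: nat set\<close>.\<close>

definition ram_bound :: "nat \<Rightarrow> (nat \<Rightarrow> cord) \<Rightarrow> cord \<Rightarrow> cord \<Rightarrow> bool" where
  "ram_bound k \<alpha> \<gamma> \<beta> \<longleftrightarrow>
     (\<forall>A C. (\<forall>i<k. sd_barrier (A i) \<and> ht (A i) = \<alpha> i \<and> final_segment (base (A i)) (base C)) \<and>
            sd_barrier C \<and> ht C = \<gamma> \<longrightarrow>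
        (\<exists>B. sd_barrier B \<and> ht B = \<beta> \<and> base B = (\<Inter>i<k. base (A i)) \<and> arrow B A k C))"

text \<open>Meaningful when some \<open>\<beta>\<close> satisfies \<^term>\<open>ram_bound k \<alpha> \<gamma> \<beta>\<close>.  Heights are countable, so
  ranging over \<^typ>\<open>cord\<close> loses no candidate.\<close>

definition Ram :: "nat \<Rightarrow> (nat \<Rightarrow> cord) \<Rightarrow> cord \<Rightarrow> cord" where
  "Ram k \<alpha> \<gamma> = (LEAST \<beta>. ram_bound k \<alpha> \<gamma> \<beta>)"

end

theory Submission
  imports Defs "HOL-Library.Multiset"
begin

text \<open>
  The tree of a smooth barrier is stable under moving sets up pointwise, and the rank on it is
  monotone for this order.  For exponent one, the sets that can be coloured so that the \<open>i\<close>-th colour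
  class is always a node of the tree of \<open>A i\<close> form again such a tree, and the arrow says that it is
  contained in the tree of \<open>B\<close>.  Adding a point to a set enlarges one colour class, so
  the rank of the merged tree obeys the recursion of the natural sum and equals
  \<open>\<alpha>\<^sub>0 \<sharp> \<dots> \<sharp> \<alpha>\<^sub>k\<^sub>-\<^sub>1\<close>.  This gives the lower bound.  For the upper bound, every smooth tree is
  contained in the tree of a decomposable smooth barrier of the same height.
\<close>

section \<open>Ordinal arithmetic\<close>

text \<open>An element of \<open>singletons X \<oplus> B\<close> is an element of \<open>B\<close>
  followed by one later point, that is, a set that has just left the tree of \<open>B\<close>. Read
  contrapositively, the arrow says: a set whose colour classes have all stayed inside the trees of
  the \<open>A i\<close> has not left the tree of \<open>B\<close>.

  Lower bounds on ranks rest on one fact: in a smooth tree a child may be replaced by one with a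
  larger last point without loss of rank. A new point of any colour can thus be placed beyond all
  points used so far, and the colour classes do not obstruct one another.

  Upper bounds meet the opposite difficulty: a node may belong to a constructed tree for several
  reasons (colourings, cut points, components), each suggesting its own rank. Their maximum still
  drops along the tree as long as each node has finitely many of them; see \<open>rk_le_Max\<close>.
  Securing this finiteness dictates the form of the constructions.

  Decomposability is the obstacle for \<open>B\<close>: a sum places the same tree above every leaf
  of its first part, while the merged tree continues differently at different nodes.\<close>

lemma zero_le_cord [simp]: "0 \<le> (a :: cord)"
  unfolding zero_cord_def by (rule Least_le) simp

lemma not_less_zero_cord [simp]: "\<not> (a :: cord) < 0"
  by (simp add: not_less)

lemma less_osuc [simp]: "a < osuc a"
  unfolding osuc_def using countable_bounded_cord[of "{a}"] by (metis LeastI countable_empty countable_insert insertI1)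

lemma osuc_le_iff: "osuc a \<le> b \<longleftrightarrow> a < b"
  using less_osuc[of a] Least_le[of "\<lambda>b. a < b" b] unfolding osuc_def[symmetric]
  by (meson less_le_trans)

lemma less_osuc_iff: "b < osuc a \<longleftrightarrow> b \<le> a"
  using osuc_le_iff[of a b] by (metis not_le)

text \<open>\<open>Sup\<close> is the least upper bound in a well-order, so this covers the empty
  set as well: its supremum is 0, which gives leaves their rank.\<close>

lemma Sup_cord_least: "(\<And>a. a \<in> A \<Longrightarrow> a \<le> b) \<Longrightarrow> Sup A \<le> (b :: cord)"
  unfolding Sup_cord_def by (rule Least_le) blast

lemma Sup_cord_upper:
  assumes "countable A" "a \<in> A"
  shows "a \<le> Sup (A :: cord set)"
proof (rule cSup_upper[OF assms(2)])
  show "bdd_above A" using countable_bounded_cord[OF assms(1)] unfolding bdd_above_def by (meson less_imp_le)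
qed

lemma less_Sup_cord_iff: "countable A \<Longrightarrow> d < Sup (A :: cord set) \<longleftrightarrow> (\<exists>a\<in>A. d < a)"
  by (meson Sup_cord_least Sup_cord_upper leD leI less_le_trans)

lemma cord_eqI: "(\<And>d. d < a \<longleftrightarrow> d < b) \<Longrightarrow> a = (b :: cord)"
  by (metis less_irrefl neqE)

text \<open>Predecessor form of the supremum clause, valid because the index set is countable.
  Ordinal identities below are proved by comparing predecessors, as in
  \<open>cord_eqI\<close>.\<close>

lemma less_oadd_iff: "d < a + b \<longleftrightarrow> d < a \<or> (\<exists>e<b. d \<le> a + (e :: cord))"
proof -
  have "a + b = Sup (insert a ((\<lambda>d. osuc (a + d)) ` {..<b}))"
    unfolding plus_cord_def by (subst oadd.simps) (rule refl)
  then show ?thesis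
    by (simp only: less_Sup_cord_iff countable_insert_eq countable_image countable_lessThan_cord)
      (auto simp: less_osuc_iff)
qed

lemma oadd_strict_mono: "d < b \<Longrightarrow> a + d < a + (b :: cord)"
  by (auto simp: less_oadd_iff)

lemma oadd_mono: "d \<le> b \<Longrightarrow> a + d \<le> a + (b :: cord)"
  using oadd_strict_mono by (metis le_less)

lemma le_oadd: "a \<le> a + (b :: cord)"
  by (meson leI less_irrefl less_oadd_iff)

lemma oadd_mono_left: "a \<le> a' \<Longrightarrow> a + b \<le> a' + (b :: cord)"
proof (induction b rule: less_induct)
  case (less b)
  show ?case
  proof (rule leI, rule notI)
    assume "a' + b < a + b"
    then show False using less by (metis le_oadd leD less_le_trans less_oadd_iff oadd_strict_mono)
  qed
qed

instance cord :: monoid_add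
proof
  fix a b c :: cord
  show "a + b + c = a + (b + c)"
  proof (induction c rule: less_induct)
    case (less c)
    have "d < a + b + c \<longleftrightarrow> d < a + (b + c)" for d
    proof -
      have "d < a + (b + c) \<longleftrightarrow> d < a \<or> (\<exists>e<b. d \<le> a + e) \<or> (\<exists>e<c. d \<le> a + (b + e))"
        unfolding less_oadd_iff[of d a "b + c"] less_oadd_iff[of _ b c]
        by (meson oadd_mono order_refl order_trans)
      then show ?thesis using less unfolding less_oadd_iff[of d "a + b" c] less_oadd_iff[of d a b] by auto
    qed
    then show ?case by (rule cord_eqI)
  qed
  show "a + 0 = a" by (rule cord_eqI) (simp add: less_oadd_iff)
  show "0 + a = a"
    by (induction a rule: less_induct, rule cord_eqI) (auto simp: less_oadd_iff intro: le_less_trans)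
qed

lemma oadd_diff:
  assumes "a \<le> (c :: cord)"
  shows "\<exists>r. c = a + r"
proof -
  \<comment> \<open>Minimality of \<open>r\<close> rules out \<open>c < a + r\<close>: a predecessor
    of \<open>a + r\<close> that is not below \<open>a\<close> is at most \<open>a + e\<close> for
    some \<open>e < r\<close>.\<close>
  define r where "r = (LEAST r. c \<le> a + r)"
  have "c \<le> a + c" using oadd_mono_left[of 0 a c] by simp
  then have "c \<le> a + r" unfolding r_def by (rule LeastI)
  moreover have "\<not> c < a + r"
    unfolding less_oadd_iff using assms not_less_Least[of _ "\<lambda>r. c \<le> a + r"] r_def by fastforce
  ultimately show ?thesis by auto
qed

lemma omult_osuc: "a * osuc b = a * b + (a :: cord)"
proof -
  have eq: "a * c = Sup ((\<lambda>d. a * d + a) ` {..<c})" for c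
    unfolding times_cord_def by (subst omult.simps) (rule refl)
  have mono: "a * d \<le> a * c" if "d \<le> c" for d c
    unfolding eq[of d]
  proof (rule Sup_cord_least)
    fix x assume "x \<in> (\<lambda>d. a * d + a) ` {..<d}"
    then show "x \<le> a * c" unfolding eq[of c] using that
      by (intro Sup_cord_upper) (auto simp: countable_lessThan_cord)
  qed
  show ?thesis
  proof (rule antisym)
    show "a * osuc b \<le> a * b + a" unfolding eq[of "osuc b"]
      by (rule Sup_cord_least) (auto simp: less_osuc_iff intro!: oadd_mono_left mono)
    show "a * b + a \<le> a * osuc b" unfolding eq[of "osuc b"]
      by (rule Sup_cord_upper) (auto simp: countable_lessThan_cord)
  qed
qed

lemma omult_zero [simp]: "a * 0 = (0 :: cord)"
proof -
  have "a * 0 = Sup ((\<lambda>d. a * d + a) ` {..<0})"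
    unfolding times_cord_def by (subst omult.simps) (rule refl)
  then show ?thesis using Sup_cord_least[of "{}" 0] by (simp add: lessThan_def antisym)
qed

lemma less_omult_iff: "d < a * b \<longleftrightarrow> (\<exists>e<b. d < a * e + (a :: cord))"
proof -
  have "a * b = Sup ((\<lambda>d. a * d + a) ` {..<b})"
    unfolding times_cord_def by (subst omult.simps) (rule refl)
  then show ?thesis by (simp add: less_Sup_cord_iff countable_lessThan_cord Bex_def)
qed

lemma less_omega_iff: "d < omega \<longleftrightarrow> (\<exists>n. d = (osuc ^^ n) 0)"
proof
  have lt: "(osuc ^^ n) 0 < omega" for n
  proof -
    have "(osuc ^^ Suc n) 0 \<le> omega" unfolding omega_def by (rule Sup_cord_upper, simp, rule rangeI)
    then show ?thesis by (simp add: osuc_le_iff)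
  qed
  then show "\<exists>n. d = (osuc ^^ n) 0 \<Longrightarrow> d < omega" by blast
  assume "d < omega"
  then obtain n where "d < (osuc ^^ n) 0" unfolding omega_def by (auto simp: less_Sup_cord_iff)
  then show "\<exists>n. d = (osuc ^^ n) 0"
    by (induction n) (auto simp: less_osuc_iff le_less)
qed

section \<open>Powers of omega and the existence of Cantor normal forms\<close>

lemma cnf_value_simps [simp]:
  "cnf_value [] = 0" "cnf_value (b # bs) = omega_pow b + cnf_value bs"
  by (simp_all add: cnf_value_def)

lemma cnf_value_append: "cnf_value (as @ bs) = cnf_value as + cnf_value bs"
  by (induction as) (simp_all add: add.assoc)

lemma cnf_value_replicate: "cnf_value (replicate n b) = omega_pow b * (osuc ^^ n) 0"
proof (induction n)
  case (Suc n)
  have "replicate (Suc n) b = replicate n b @ [b]" by (simp add: replicate_append_same)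
  then show ?case using Suc by (simp only: cnf_value_append) (simp add: omult_osuc)
qed simp

text \<open>\<open>omega\<close> is the supremum of the finite ordinals, so a predecessor of
  \<open>omega_pow e * omega\<close> lies below a finite multiple of \<open>omega_pow e\<close>.
  Writing the multiple as a normal form with a repeated exponent eliminates products from everything
  that follows.\<close>

lemma less_omega_pow_iff:
  "d < omega_pow b \<longleftrightarrow> d = 0 \<or> (\<exists>e<b. \<exists>n. d < cnf_value (replicate n e))"
proof -
  have "omega_pow b = Sup (insert 1 ((\<lambda>d. omega_pow d * omega) ` {..<b}))"
    by (subst omega_pow.simps) (rule refl)
  then have "d < omega_pow b \<longleftrightarrow> d < 1 \<or> (\<exists>e<b. d < omega_pow e * omega)"
    by (simp only: less_Sup_cord_iff countable_insert_eq countable_image countable_lessThan_cord bex_simps image_iff) auto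
  moreover have "d < (1 :: cord) \<longleftrightarrow> d = 0"
    unfolding one_cord_def less_osuc_iff by (simp add: antisym_conv)
  moreover have "d < omega_pow e * omega \<longleftrightarrow> (\<exists>n. d < cnf_value (replicate n e))" for e
  proof -
    \<comment> \<open>\<open>less_omult_iff\<close> bounds \<open>d\<close> by \<open>n\<close>
      copies plus one more, hence \<open>Suc n\<close>; the value for zero copies is 0, which bounds
      nothing.\<close>
    have "d < omega_pow e * omega \<longleftrightarrow> (\<exists>n. d < cnf_value (replicate (Suc n) e))"
      unfolding cnf_value_replicate less_omult_iff[of d _ omega] less_omega_iff
      by (auto simp: omult_osuc)
    also have "\<dots> \<longleftrightarrow> (\<exists>n. d < cnf_value (replicate n e))"
      by (metis cnf_value_simps(1) not0_implies_Suc not_less_zero_cord replicate_empty)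
    finally show ?thesis .
  qed
  ultimately show ?thesis by simp
qed

lemma omega_pow_pos [simp]: "0 < omega_pow b"
  by (simp add: less_omega_pow_iff)

lemma omega_pow_mono: "a \<le> b \<Longrightarrow> omega_pow a \<le> omega_pow b"
  by (rule leI, rule notI) (metis leD less_irrefl less_le_trans less_omega_pow_iff)

lemma cnf_value_replicate_less: "e < b \<Longrightarrow> cnf_value (replicate n e) < omega_pow b"
proof -
  assume "e < b"
  moreover have "cnf_value (replicate n e) < cnf_value (replicate (Suc n) e)"
    using oadd_strict_mono[OF omega_pow_pos[of e], of "cnf_value (replicate n e)"]
    by (simp only: replicate_Suc replicate_append_same[symmetric] cnf_value_append) simp
  ultimately show ?thesis using less_omega_pow_iff by blast
qed

lemma omega_pow_strict_mono: "a < b \<Longrightarrow> omega_pow a < omega_pow b"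
  using cnf_value_replicate_less[of a b 1] by simp

text \<open>Additive indecomposability: two nonzero summands lie below finite multiples of the power
  with the larger of their exponents, so the sum is bounded by a finite multiple of it too.\<close>

lemma oadd_less_omega_pow:
  assumes "x < omega_pow b" "y < omega_pow b"
  shows "x + y < omega_pow b"
proof (cases "x = 0 \<or> y = 0")
  case False
  with assms obtain d n e m where d: "d < b" "x < cnf_value (replicate n d)"
    and e: "e < b" "y < cnf_value (replicate m e)"
    unfolding less_omega_pow_iff by blast
  have mono: "cnf_value (replicate n a) \<le> cnf_value (replicate n c)" if "a \<le> c" for a c n
  proof (induction n)
    case (Suc n)
    then show ?case
      by simp (meson oadd_mono oadd_mono_left omega_pow_mono order_trans that)
  qed simp
  define c where "c = max d e"
  have c: "c < b" "x \<le> cnf_value (replicate n c)" "y \<le> cnf_value (replicate m c)"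
    using d e mono[of d c n] mono[of e c m] unfolding c_def by auto
  have "x + y \<le> cnf_value (replicate (n + m) c)"
    unfolding replicate_add cnf_value_append
    using c by (meson oadd_mono oadd_mono_left order_trans)
  also have "\<dots> < omega_pow b" using c(1) by (rule cnf_value_replicate_less)
  finally show ?thesis .
qed (use assms in auto)

lemma cnf_value_less_omega_pow: "\<forall>x\<in>set bs. x < b \<Longrightarrow> cnf_value bs < omega_pow b"
  by (induction bs) (auto intro!: oadd_less_omega_pow omega_pow_strict_mono)

text \<open>The leading power is split off on the left, and the induction hypothesis normalizes the
  strictly smaller remainder.\<close>

lemma cnf_exists: "\<exists>bs. is_cnf a bs"
proof (induction a rule: less_induct)
  case (less a)
  show ?case
  proof (cases "a = 0")
    case True
    then show ?thesis by (intro exI[of _ "[]"]) (simp add: is_cnf_def)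
  next
    case False
    have le_pow: "c \<le> omega_pow c" for c
    proof (induction c rule: less_induct)
      case (less c)
      show ?case
        by (rule leI, rule notI) (metis less leD less_imp_le omega_pow_strict_mono)
    qed
    \<comment> \<open>The least power above \<open>a\<close> yields an exponent
      \<open>e < b'\<close> such that a finite multiple of \<open>omega_pow e\<close> exceeds
      \<open>a\<close>, while minimality of \<open>b'\<close> keeps \<open>omega_pow e\<close>
      itself at or below \<open>a\<close>.\<close>
    define b' where "b' = (LEAST b. a < omega_pow b)"
    have "a < omega_pow (osuc a)"
      using le_pow[of "osuc a"] less_osuc by (meson less_le_trans)
    then have b': "a < omega_pow b'" unfolding b'_def by (rule LeastI)
    then obtain e n where "e < b'" and n: "a < cnf_value (replicate n e)"
      using False unfolding less_omega_pow_iff by blast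
    then have e: "omega_pow e \<le> a" using not_less_Least[of e] unfolding b'_def by force
    then obtain r where r: "a = omega_pow e + r" using oadd_diff by blast
    \<comment> \<open>Otherwise \<open>omega_pow e + a \<le> a\<close>, so all finite multiples of
      \<open>omega_pow e\<close> stay at or below \<open>a\<close>, against the choice of
      \<open>n\<close>.\<close>
    have "r < a"
    proof (rule ccontr)
      assume "\<not> r < a"
      then have "omega_pow e + a \<le> a" using r oadd_mono[of a r "omega_pow e"] by simp
      then have "cnf_value (replicate k e) \<le> a" for k
        by (induction k) (auto intro: order_trans oadd_mono)
      with n show False by (simp add: leD)
    qed
    with less obtain bs where bs: "sorted_wrt (\<ge>) bs" "r = cnf_value bs"
      unfolding is_cnf_def by blast
    have "x \<le> e" if x: "x \<in> set bs" for x
    proof (rule leI, rule notI)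
      assume "e < x"
      then have lt: "cnf_value (replicate n e) < omega_pow x" by (rule cnf_value_replicate_less)
      obtain us vs where "bs = us @ x # vs" using x by (meson split_list)
      then have "r = cnf_value us + (omega_pow x + cnf_value vs)" using bs by (simp add: cnf_value_append)
      moreover have "omega_pow x \<le> omega_pow x + cnf_value vs" by (rule le_oadd)
      moreover have "\<dots> \<le> cnf_value us + \<dots>" using oadd_mono_left[of 0 "cnf_value us"] by simp
      ultimately have "omega_pow x \<le> r" by simp
      with lt n \<open>r < a\<close> show False by simp
    qed
    then have "is_cnf a (e # bs)" using bs r by (auto simp: is_cnf_def)
    then show ?thesis by blast
  qed
qed

subsection \<open>The natural sum\<close>

text \<open>A normal form is determined by the multiset of its exponents. In this coding the natural
  sum is multiset union, and its monotonicity becomes a statement about multiplicities.\<close>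

definition mset_value :: "cord multiset \<Rightarrow> cord" where
  "mset_value M = cnf_value (rev (sorted_list_of_multiset M))"

lemma sorted_desc_eq:
  assumes "sorted_wrt (\<ge>) (as :: cord list)"
  shows "rev (sorted_list_of_multiset (mset as)) = as"
proof -
  have "sorted (rev as)" using assms by (simp add: sorted_wrt_rev)
  then have "sorted_list_of_multiset (mset (rev as)) = rev as"
    by (metis sorted_list_of_multiset_mset sorted_sort_id)
  then show ?thesis by simp
qed

lemma is_cnf_value: "is_cnf a as \<Longrightarrow> a = mset_value (mset as)"
  unfolding is_cnf_def mset_value_def by (simp only: sorted_desc_eq)

lemma sorted_desc_split:
  "sorted_wrt (\<ge>) (as :: cord list) \<Longrightarrow>
   as = filter (\<lambda>x. e < x) as @ replicate (count (mset as) e) e @ filter (\<lambda>x. x < e) as"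
proof (induction as)
  case (Cons a as)
  consider "e < a" | "a = e" | "a < e" by fastforce
  then show ?case
  proof cases
    case 1
    then show ?thesis using Cons by auto
  next
    case 2
    then have "filter (\<lambda>x. e < x) as = []" using Cons.prems by (auto simp: filter_empty_conv)
    then show ?thesis using Cons 2 by simp
  next
    case 3
    then have "filter (\<lambda>x. e < x) as = []" "e \<notin> set as" "filter (\<lambda>x. x < e) as = as"
      using Cons.prems by (auto simp: filter_empty_conv filter_id_conv)
    then show ?thesis using 3 by (auto simp: count_eq_zero_iff)
  qed
qed simp

text \<open>Normal forms are compared lexicographically from the top. Above \<open>e\<close> the two
  share a prefix; whatever \<open>M\<close> has below \<open>e\<close> is smaller than a single
  additional \<open>omega_pow e\<close>, which \<open>N\<close> contains.\<close>

lemma mset_value_less: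
  assumes less: "count M e < count N e" and eq: "\<And>x. e < x \<Longrightarrow> count M x = count N x"
  shows "mset_value M < mset_value N"
proof -
  define as bs where "as = rev (sorted_list_of_multiset M)" and "bs = rev (sorted_list_of_multiset N)"
  have m: "mset as = M" "mset bs = N" by (simp_all add: as_def bs_def)
  have srt: "sorted_wrt (\<ge>) as" "sorted_wrt (\<ge>) bs" by (simp_all add: as_def bs_def sorted_wrt_rev)
  have "mset (filter (\<lambda>x. e < x) as) = mset (filter (\<lambda>x. e < x) bs)"
    using eq by (intro multiset_eqI) (simp add: m)
  moreover have "sorted_wrt (\<ge>) (filter (\<lambda>x. e < x) as)" "sorted_wrt (\<ge>) (filter (\<lambda>x. e < x) bs)"
    using srt by (simp_all add: sorted_wrt_filter)
  ultimately have G: "filter (\<lambda>x. e < x) as = filter (\<lambda>x. e < x) bs" (is "_ = ?G") by (metis sorted_desc_eq)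
  define c where "c = cnf_value (?G @ replicate (count M e) e)"
  have "mset_value M = cnf_value as" by (simp add: mset_value_def as_def)
  also have "\<dots> = c + cnf_value (filter (\<lambda>x. x < e) as)"
    by (subst sorted_desc_split[OF srt(1), of e]) (simp add: c_def G m cnf_value_append add.assoc)
  also have "\<dots> < c + omega_pow e"
    by (intro oadd_strict_mono cnf_value_less_omega_pow) simp
  also have "\<dots> \<le> c + cnf_value (replicate (count N e - count M e) e)"
  proof (rule oadd_mono)
    obtain k where "count N e - count M e = Suc k" using less by (metis Suc_diff_Suc)
    then show "omega_pow e \<le> cnf_value (replicate (count N e - count M e) e)" by (simp add: le_oadd)
  qed
  also have "\<dots> = cnf_value (?G @ replicate (count N e) e)"
    using less by (simp add: c_def cnf_value_append add.assoc flip: replicate_add) (simp add: flip: cnf_value_append replicate_add)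
  also have "\<dots> \<le> cnf_value (?G @ replicate (count N e) e) + cnf_value (filter (\<lambda>x. x < e) bs)"
    by (rule le_oadd)
  also have "\<dots> = cnf_value bs"
    using arg_cong[OF sorted_desc_split[OF srt(2), of e], of cnf_value]
    by (simp add: m cnf_value_append add.assoc)
  also have "\<dots> = mset_value N" by (simp add: mset_value_def bs_def)
  finally show ?thesis .
qed

lemma mset_diff_top:
  assumes "M \<noteq> (N :: cord multiset)"
  obtains e where "count M e \<noteq> count N e" "\<And>x. e < x \<Longrightarrow> count M x = count N x"
proof -
  let ?D = "{x. count M x \<noteq> count N x}"
  have "?D \<subseteq> set_mset M \<union> set_mset N" by (auto simp: not_in_iff)
  then have fin: "finite ?D" by (rule finite_subset) simp
  have "?D \<noteq> {}" using assms by (auto simp: multiset_eq_iff)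
  with fin have "Max ?D \<in> ?D" by (rule Max_in)
  moreover have "count M x = count N x" if "Max ?D < x" for x
  proof (rule ccontr)
    assume "count M x \<noteq> count N x"
    then have "x \<le> Max ?D" using fin by (intro Max_ge) simp_all
    with that show False by simp
  qed
  ultimately show ?thesis using that by blast
qed

lemma mset_value_less_iff:
  "mset_value M < mset_value N \<longleftrightarrow>
    (\<exists>e. count M e < count N e \<and> (\<forall>x>e. count M x = count N x))"
proof
  assume lt: "mset_value M < mset_value N"
  then have "M \<noteq> N" by auto
  then obtain e where e: "count M e \<noteq> count N e" "\<And>x. e < x \<Longrightarrow> count M x = count N x"
    using mset_diff_top[of M N] by blast
  moreover have "\<not> count N e < count M e"
    using mset_value_less[of N e M] e(2) lt by force
  ultimately have "count M e < count N e" by simp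
  with e(2) show "\<exists>e. count M e < count N e \<and> (\<forall>x>e. count M x = count N x)" by blast
qed (use mset_value_less in blast)

lemma mset_value_inject: "mset_value M = mset_value N \<longleftrightarrow> M = N"
  by (metis less_irrefl linorder_neqE_nat mset_diff_top mset_value_less)

lemma mset_value_exists: "\<exists>M. a = mset_value M"
  using cnf_exists is_cnf_value by blast

text \<open>Uniqueness of Cantor normal forms, in the guise of \<open>mset_value_inject\<close>,
  shows that the definite description in \<open>hsum\<close> denotes.\<close>

lemma hsum_mset_value: "mset_value M \<sharp> mset_value N = mset_value (M + N)"
  unfolding hsum_def
proof (rule the_equality)
  have cnf: "is_cnf (mset_value K) (rev (sorted_list_of_multiset K))" for K
    by (simp add: is_cnf_def mset_value_def sorted_wrt_rev)
  have val: "cnf_value (rev (sort (as @ bs))) = mset_value (mset as + mset bs)" for as bs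
    by (metis mset_append mset_value_def sorted_list_of_multiset_mset)
  show "\<exists>as bs. is_cnf (mset_value M) as \<and> is_cnf (mset_value N) bs \<and>
      mset_value (M + N) = cnf_value (rev (sort (as @ bs)))"
    using cnf by (intro exI conjI) (rule cnf, rule cnf, simp add: val)
  fix c assume "\<exists>as bs. is_cnf (mset_value M) as \<and> is_cnf (mset_value N) bs \<and>
      c = cnf_value (rev (sort (as @ bs)))"
  then show "c = mset_value (M + N)" using is_cnf_value val by (metis mset_value_inject)
qed

lemma hsum_commute: "a \<sharp> b = b \<sharp> a"
  by (metis add.commute hsum_mset_value mset_value_exists)

lemma hsum_strict_mono_left: "a < b \<Longrightarrow> a \<sharp> c < b \<sharp> c"
proof -
  obtain K M N where "a = mset_value K" "b = mset_value M" "c = mset_value N"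
    using mset_value_exists by metis
  then show "a < b \<Longrightarrow> a \<sharp> c < b \<sharp> c" by (simp add: hsum_mset_value mset_value_less_iff)
qed

lemma hsum_strict_mono_right: "a < b \<Longrightarrow> c \<sharp> a < c \<sharp> b"
  using hsum_strict_mono_left[of a b c] by (simp add: hsum_commute)

lemma mset_value_add_small:
  assumes "\<And>x. x \<in># M \<Longrightarrow> e \<le> x"
  shows "mset_value (M + replicate_mset n e) = mset_value M + cnf_value (replicate n e)"
proof -
  define as where "as = rev (sorted_list_of_multiset M)"
  have as: "sorted_wrt (\<ge>) as" "mset as = M" by (simp_all add: as_def sorted_wrt_rev)
  have "x \<in> set as \<Longrightarrow> e \<le> x" for x using assms as(2) by (metis set_mset_mset)
  moreover have "sorted_wrt (\<ge>) (replicate n e)" by (induction n) auto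
  ultimately have "sorted_wrt (\<ge>) (as @ replicate n e)" using as by (auto simp: sorted_wrt_append)
  then have "mset_value (mset (as @ replicate n e)) = cnf_value (as @ replicate n e)"
    unfolding mset_value_def by (subst sorted_desc_eq) simp_all
  moreover have "mset_value M = cnf_value as" by (simp add: mset_value_def as_def)
  ultimately show ?thesis by (simp add: as cnf_value_append)
qed

text \<open>The least exponent of the merged normal form may be taken from either summand; lowering its
  last occurrence lowers that summand.\<close>

lemma less_mset_valueE:
  assumes "d < mset_value (add_mset e M)" "\<And>x. x \<in># M \<Longrightarrow> e \<le> x"
  obtains K where "d \<le> mset_value (K + M)" "\<And>N. mset_value (K + N) < mset_value (add_mset e N)"
proof -
  have "mset_value (add_mset e M) = mset_value M + omega_pow e"
    using mset_value_add_small[OF assms(2), where n = 1] by simp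
  with assms(1) consider "d < mset_value M" | x where "x < omega_pow e" "d \<le> mset_value M + x"
    using less_oadd_iff by auto
  then have "\<exists>K. d \<le> mset_value (K + M) \<and> (\<forall>x\<in>#K. x < e)"
  proof cases
    case 1
    then show ?thesis by (intro exI[of _ "{#}"]) simp
  next
    case 2
    show ?thesis
    proof (cases "x = 0")
      case True
      with 2 show ?thesis by (intro exI[of _ "{#}"]) simp
    next
      case False
      with 2(1) obtain e' n where e': "e' < e" "x < cnf_value (replicate n e')"
        unfolding less_omega_pow_iff by blast
      have "d \<le> mset_value M + cnf_value (replicate n e')"
        using 2(2) e'(2) by (meson less_imp_le oadd_mono order_trans)
      also have "\<dots> = mset_value (M + replicate_mset n e')"
        using e'(1) assms(2) by (subst mset_value_add_small) (auto intro: less_imp_le less_le_trans)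
      finally show ?thesis using e'(1) by (intro exI[of _ "replicate_mset n e'"]) (auto simp: add.commute)
    qed
  qed
  then obtain K where K: "d \<le> mset_value (K + M)" "\<And>x. x \<in># K \<Longrightarrow> x < e" by blast
  moreover have "mset_value (K + N) < mset_value (add_mset e N)" for N
  proof (rule mset_value_less)
    have "count K x = 0" if "e \<le> x" for x using K(2)[of x] that by (auto simp: not_in_iff[symmetric])
    then show "count (K + N) e < count (add_mset e N) e"
      "\<And>x. e < x \<Longrightarrow> count (K + N) x = count (add_mset e N) x" by auto
  qed
  ultimately show ?thesis using that by blast
qed

text \<open>Together with strict monotonicity this is the recursion of the natural sum, the least
  ordinal above all sums with one summand lowered. Its list version \<open>less_hsum_listE\<close>
  drives the lower bound for the rank of a merged tree.\<close>

lemma less_hsumE: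
  assumes "d < a \<sharp> b"
  obtains a' where "a' < a" "d \<le> a' \<sharp> b" | b' where "b' < b" "d \<le> a \<sharp> b'"
proof -
  obtain M N where M: "a = mset_value M" and N: "b = mset_value N"
    using mset_value_exists by metis
  have lt: "d < mset_value (M + N)" using assms by (simp add: M N hsum_mset_value)
  have "M + N \<noteq> {#}"
  proof
    assume "M + N = {#}"
    then have "mset_value (M + N) = 0" by (simp add: mset_value_def)
    with lt show False by simp
  qed
  define e where "e = Min (set_mset (M + N))"
  have "e \<in># M + N" unfolding e_def using \<open>M + N \<noteq> {#}\<close> by (intro Min_in) auto
  have le: "e \<le> x" if "x \<in># M + N" for x using that unfolding e_def by (intro Min_le) auto
  from \<open>e \<in># M + N\<close> consider "e \<in># M" | "e \<in># N" by auto
  then show thesis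
  proof cases
    case 1
    then obtain M' where M': "M = add_mset e M'" by (metis mset_add)
    obtain K where "d \<le> mset_value (K + (M' + N))"
        "\<And>N. mset_value (K + N) < mset_value (add_mset e N)"
      using less_mset_valueE[of d e "M' + N"] lt le unfolding M' by auto
    then show ?thesis
      using that(1)[of "mset_value (K + M')"] by (simp add: M N M' hsum_mset_value add.assoc)
  next
    case 2
    then obtain N' where N': "N = add_mset e N'" by (metis mset_add)
    obtain K where "d \<le> mset_value (K + (M + N'))"
        "\<And>N. mset_value (K + N) < mset_value (add_mset e N)"
      using less_mset_valueE[of d e "M + N'"] lt le unfolding N' by auto
    then show ?thesis
      using that(2)[of "mset_value (K + N')"]
      by (simp add: M N N' hsum_mset_value add.left_commute[of M K])
  qed
qed

lemma hsum_list_snoc: "hsum_list (as @ [a]) = hsum_list as \<sharp> a"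
  by (simp add: hsum_list_def)

lemma hsum_list_strict_mono:
  "i < k \<Longrightarrow> b < a i \<Longrightarrow> hsum_list (map (a(i := b)) [0..<k]) < hsum_list (map a [0..<k])"
proof (induction k)
  case (Suc k)
  show ?case
  proof (cases "i = k")
    case True
    then have "map (a(i := b)) [0..<k] = map a [0..<k]" by simp
    then show ?thesis using True Suc.prems
      by (simp add: hsum_list_snoc hsum_strict_mono_right del: fun_upd_apply) (simp add: hsum_strict_mono_right)
  next
    case False
    then show ?thesis using Suc by (simp add: hsum_list_snoc hsum_strict_mono_left)
  qed
qed simp

lemma hsum_list_mono:
  "(\<And>i. i < k \<Longrightarrow> a i \<le> b i) \<Longrightarrow> hsum_list (map a [0..<k]) \<le> hsum_list (map b [0..<k])"
proof (induction k)
  case (Suc k)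
  then have "hsum_list (map a [0..<k]) \<le> hsum_list (map b [0..<k])" "a k \<le> b k" by auto
  then show ?case
    unfolding upt_Suc_append[OF le0] map_append list.map hsum_list_snoc le_less
    by (auto intro: hsum_strict_mono_left hsum_strict_mono_right less_trans)
qed simp

lemma less_hsum_listE:
  assumes "d < hsum_list (map a [0..<k])"
  obtains i b where "i < k" "b < a i" "d \<le> hsum_list (map (a(i := b)) [0..<k])"
  using assms
proof (induction k arbitrary: d thesis)
  case 0
  then show ?case by (simp add: hsum_list_def)
next
  case (Suc k)
  from Suc.prems(2) have "d < hsum_list (map a [0..<k]) \<sharp> a k" by (simp add: hsum_list_snoc)
  then show ?case
  proof (cases rule: less_hsumE)
    case (1 c)
    obtain i b where i: "i < k" "b < a i" "c \<le> hsum_list (map (a(i := b)) [0..<k])"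
      using Suc.IH[OF _ 1(1)] by blast
    have "d \<le> hsum_list (map (a(i := b)) [0..<Suc k])"
      using 1(2) i hsum_strict_mono_left[of c "hsum_list (map (a(i := b)) [0..<k])" "a k"]
      by (auto simp: hsum_list_snoc le_less simp del: fun_upd_apply) (auto intro: less_trans)
    then show ?thesis using Suc.prems(1)[of i b] i less_SucI by blast
  next
    case (2 b)
    have "map (a(k := b)) [0..<k] = map a [0..<k]" by simp
    then have "d \<le> hsum_list (map (a(k := b)) [0..<Suc k])" using 2 by (simp add: hsum_list_snoc)
    then show ?thesis using Suc.prems(1)[of k b] 2 lessI by blast
  qed
qed

section \<open>Pointwise domination and initial segments\<close>

text \<open>The map \<open>h\<close> is an order isomorphism that moves no point down. Using a map
  instead of enumerations lets initial parts, remainders and colour classes inherit the relation by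
  restriction.\<close>

definition pointwise_le :: "nat set \<Rightarrow> nat set \<Rightarrow> bool" (infix "\<preceq>" 50) where
  "s \<preceq> t \<longleftrightarrow> (\<exists>h. strict_mono_on s h \<and> h ` s = t \<and> (\<forall>x\<in>s. x \<le> h x))"

lemma pointwise_le_refl [simp]: "s \<preceq> s"
  unfolding pointwise_le_def by (intro exI[of _ id]) (simp add: strict_mono_on_def)

lemma pointwise_le_card: "s \<preceq> t \<Longrightarrow> card s = card t"
  unfolding pointwise_le_def by (metis card_image strict_mono_on_imp_inj_on)

lemma pointwise_le_finite: "s \<preceq> t \<Longrightarrow> finite s \<Longrightarrow> finite t"
  unfolding pointwise_le_def by blast

lemma pointwise_le_empty [simp]: "{} \<preceq> t \<longleftrightarrow> t = {}" "s \<preceq> {} \<longleftrightarrow> s = {}"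
  unfolding pointwise_le_def by (auto simp: strict_mono_on_def)

lemma pointwise_le_above: "s \<preceq> t \<Longrightarrow> \<forall>x\<in>s. a < x \<Longrightarrow> \<forall>y\<in>t. a < y"
  unfolding pointwise_le_def by force

lemma pointwise_le_insert:
  assumes "s \<preceq> t" "\<forall>x\<in>s. x < n" "\<forall>y\<in>t. y < m" "n \<le> m"
  shows "insert n s \<preceq> insert m t"
proof -
  obtain h where h: "strict_mono_on s h" "h ` s = t" "\<forall>x\<in>s. x \<le> h x"
    using assms(1) unfolding pointwise_le_def by blast
  have n: "n \<notin> s" using assms(2) by blast
  have "(h(n := m)) ` insert n s = insert m t" using n h(2) by auto
  moreover have "strict_mono_on (insert n s) (h(n := m))"
    using h(1,2) assms(2,3) n unfolding strict_mono_on_def by (auto dest: less_asym)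
  ultimately show ?thesis
    unfolding pointwise_le_def using h(3) n assms(4) by (intro exI[of _ "h(n := m)"]) auto
qed

lemma pointwise_le_insertE:
  assumes "insert n s \<preceq> t" "\<forall>x\<in>s. x < n"
  obtains m u where "t = insert m u" "\<forall>y\<in>u. y < m" "s \<preceq> u" "n \<le> m"
proof -
  obtain h where h: "strict_mono_on (insert n s) h" "h ` insert n s = t" "\<forall>x\<in>insert n s. x \<le> h x"
    using assms(1) unfolding pointwise_le_def by blast
  have "strict_mono_on s h" using h(1) by (auto simp: strict_mono_on_def)
  moreover have "\<forall>x\<in>s. h x < h n" using h(1) assms(2) by (auto simp: strict_mono_on_def)
  ultimately show thesis using h that[of "h n" "h ` s"] unfolding pointwise_le_def by auto
qed

lemma pointwise_le_Un:
  assumes "s \<preceq> t" "\<forall>x\<in>p. \<forall>y\<in>s. x < y"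
  shows "p \<union> s \<preceq> p \<union> t"
proof -
  obtain h where h: "strict_mono_on s h" "h ` s = t" "\<forall>x\<in>s. x \<le> h x"
    using assms(1) unfolding pointwise_le_def by blast
  let ?h = "\<lambda>x. if x \<in> p then x else h x"
  have disj: "x \<notin> p" if "x \<in> s" for x using assms(2) that by blast
  have "?h ` (p \<union> s) = p \<union> t" using h(2) disj by (force simp: image_iff)
  moreover have "strict_mono_on (p \<union> s) ?h"
    unfolding strict_mono_on_def
  proof (intro allI impI)
    fix x y assume "x \<in> p \<union> s \<and> y \<in> p \<union> s \<and> x < y"
    then show "?h x < ?h y"
      using assms(2) disj h(1,3) unfolding strict_mono_on_def
      by (auto intro: less_le_trans dest: less_asym)
  qed
  ultimately show ?thesis unfolding pointwise_le_def using h(3) by (intro exI[of _ ?h]) auto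
qed

text \<open>The colouring is transported along the order isomorphism, which restricts to every
  colour class.\<close>

lemma pointwise_le_colouring:
  fixes c :: "nat \<Rightarrow> 'a"
  assumes "s \<preceq> t"
  obtains c' where "c' ` t \<subseteq> c ` s" "\<And>i. {x \<in> s. c x = i} \<preceq> {x \<in> t. c' x = i}"
proof -
  obtain h where h: "strict_mono_on s h" "h ` s = t" "\<forall>x\<in>s. x \<le> h x"
    using assms(1) unfolding pointwise_le_def by blast
  have inj: "inj_on h s" using h(1) by (rule strict_mono_on_imp_inj_on)
  define c' where "c' = c \<circ> the_inv_into s h"
  have c': "c' (h x) = c x" if "x \<in> s" for x using inj that by (simp add: c'_def the_inv_into_f_f)
  have "{x \<in> s. c x = i} \<preceq> {x \<in> t. c' x = i}" for i
    unfolding pointwise_le_def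
    using h c' by (intro exI[of _ h]) (auto simp: strict_mono_on_def)
  moreover have "c' ` t \<subseteq> c ` s" using c' h(2) by auto
  ultimately show thesis using that by blast
qed

lemma pointwise_le_sorted_lists:
  "sorted_wrt (<) xs \<Longrightarrow> sorted_wrt (<) ys \<Longrightarrow> length xs = length ys \<Longrightarrow>
   (\<And>i. i < length xs \<Longrightarrow> xs ! i \<le> ys ! i) \<Longrightarrow> set xs \<preceq> set ys"
proof (induction xs arbitrary: ys rule: rev_induct)
  case (snoc x xs)
  obtain zs z where ys: "ys = zs @ [z]" using snoc.prems(3) by (cases ys rule: rev_cases) auto
  have "xs ! i \<le> zs ! i" if "i < length xs" for i
    using snoc.prems(3) snoc.prems(4)[of i] that by (simp add: ys nth_append)
  then have "set xs \<preceq> set zs" using snoc by (simp add: ys sorted_wrt_append)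
  moreover have "x \<le> z" using snoc.prems(3) snoc.prems(4)[of "length xs"] by (simp add: ys nth_append)
  ultimately have "insert x (set xs) \<preceq> insert z (set zs)"
    using snoc.prems(1,2) by (intro pointwise_le_insert) (auto simp: ys sorted_wrt_append)
  then show ?case by (simp add: ys)
qed simp

lemma pointwise_le_nth:
  assumes "s \<preceq> t" "finite s" "i < card s"
  shows "sorted_list_of_set s ! i \<le> sorted_list_of_set t ! i"
proof -
  obtain h where h: "strict_mono_on s h" "h ` s = t" "\<forall>x\<in>s. x \<le> h x"
    using assms(1) unfolding pointwise_le_def by blast
  have "sorted_wrt (<) (map h (sorted_list_of_set s))"
    unfolding sorted_wrt_map
    by (rule sorted_wrt_mono_rel[OF _ strict_sorted_list_of_set])
      (use h(1) assms(2) in \<open>auto simp: strict_mono_on_def\<close>)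
  then have "sorted_list_of_set t = map h (sorted_list_of_set s)"
    by (intro strict_sorted_equal) (use assms(2) h(2) in auto)
  then show ?thesis using h(3) assms(2,3)
    by (metis nth_map nth_mem set_sorted_list_of_set length_sorted_list_of_set)
qed

section \<open>Initial segments and their interplay with pointwise domination\<close>

lemma init_seg_refl [simp]: "init_seg s s"
  by (simp add: init_seg_def)

lemma init_seg_empty [simp]: "init_seg {} s"
  by (simp add: init_seg_def)

lemma init_seg_trans: "init_seg s t \<Longrightarrow> init_seg t u \<Longrightarrow> init_seg s u"
  unfolding init_seg_def by blast

lemma init_seg_insert: "\<forall>x\<in>s. x < n \<Longrightarrow> init_seg s (insert n s)"
  unfolding init_seg_def by auto

lemma pinit_seg_insert: "\<forall>x\<in>s. x < n \<Longrightarrow> pinit_seg s (insert n s)"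
  unfolding pinit_seg_def using init_seg_insert[of s n] by auto

lemma pinit_seg_insert_iff:
  assumes "\<forall>x\<in>s. x < n"
  shows "pinit_seg u (insert n s) \<longleftrightarrow> init_seg u s"
proof
  assume "init_seg u s"
  then have "init_seg u (insert n s)" using assms init_seg_insert init_seg_trans by blast
  moreover have "n \<notin> u" using \<open>init_seg u s\<close> assms unfolding init_seg_def by blast
  ultimately show "pinit_seg u (insert n s)" by (auto simp: pinit_seg_def)
next
  assume "pinit_seg u (insert n s)"
  then have u: "u \<subseteq> insert n s" "u \<noteq> insert n s" "\<forall>x\<in>u. \<forall>y\<in>insert n s - u. x < y"
    unfolding pinit_seg_def init_seg_def by auto
  then obtain y where "y \<in> insert n s - u" by blast
  then have "n \<notin> u" using u(3) assms by (auto dest: less_asym)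
  then show "init_seg u s" using u unfolding init_seg_def by blast
qed

lemma init_seg_comparable:
  assumes "init_seg s u" "init_seg t u"
  shows "init_seg s t \<or> pinit_seg t s"
proof (cases "s \<subseteq> t")
  case True
  then show ?thesis using assms unfolding init_seg_def by blast
next
  case False
  then obtain x where x: "x \<in> s" "x \<notin> t" by blast
  have "t \<subseteq> s"
  proof
    fix y assume "y \<in> t"
    then have "y < x" using assms x unfolding init_seg_def by blast
    then have "\<not> x < y" by simp
    then show "y \<in> s" using assms x(1) \<open>y \<in> t\<close> unfolding init_seg_def by blast
  qed
  then show ?thesis using assms x unfolding init_seg_def pinit_seg_def by blast
qed

lemma init_seg_take:
  assumes "sorted_wrt (<) xs"
  shows "init_seg (set (take n xs)) (set xs)"
proof -
  have "init_seg (set us) (set (us @ vs))" if "sorted_wrt (<) (us @ vs)" for us vs :: "nat list"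
    using that by (auto simp: sorted_wrt_append init_seg_def)
  from this[of "take n xs" "drop n xs"] assms show ?thesis by simp
qed

lemma init_seg_card: "init_seg s t \<Longrightarrow> finite t \<Longrightarrow> card s \<le> card t"
  unfolding init_seg_def by (simp add: card_mono)

lemma pinit_seg_card: "pinit_seg s t \<Longrightarrow> finite t \<Longrightarrow> card s < card t"
  unfolding init_seg_def pinit_seg_def by (metis psubsetI psubset_card_mono)

lemma pinit_seg_next:
  assumes "pinit_seg s t"
  obtains n where "n \<in> t" "\<forall>x\<in>s. x < n" "\<forall>x\<in>t - s. n \<le> x" "init_seg (insert n s) t"
proof -
  have s: "s \<subseteq> t" "s \<noteq> t" "\<forall>x\<in>s. \<forall>y\<in>t - s. x < y"
    using assms unfolding pinit_seg_def init_seg_def by auto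
  define n where "n = (LEAST n. n \<in> t - s)"
  have "\<exists>n. n \<in> t - s" using s by blast
  then have n: "n \<in> t - s" unfolding n_def by (rule LeastI_ex)
  have le: "\<forall>x\<in>t - s. n \<le> x" unfolding n_def by (auto intro: Least_le)
  then have "init_seg (insert n s) t" using s n unfolding init_seg_def by (auto simp: le_less)
  with n le s that show thesis by blast
qed

lemma pointwise_le_split:
  assumes "finite s" "s \<preceq> t" "init_seg u t"
  obtains v where "init_seg v s" "v \<preceq> u" "s - v \<preceq> t - u"
proof -
  obtain h where h: "strict_mono_on s h" "h ` s = t" "\<forall>x\<in>s. x \<le> h x"
    using assms(2) unfolding pointwise_le_def by blast
  let ?v = "{x \<in> s. h x \<in> u}"
  have "init_seg ?v s"
    unfolding init_seg_def
  proof (intro conjI ballI)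
    fix x y assume "x \<in> ?v" "y \<in> s - ?v"
    then have "h x < h y" using assms(3) h(2) unfolding init_seg_def by blast
    then show "x < y" using strict_mono_on_less[OF h(1), of x y] \<open>x \<in> ?v\<close> \<open>y \<in> s - ?v\<close> by simp
  qed auto
  moreover have "?v \<preceq> u"
    unfolding pointwise_le_def using h assms(3)
    by (intro exI[of _ h]) (auto simp: strict_mono_on_def init_seg_def)
  moreover have "s - ?v \<preceq> t - u"
    unfolding pointwise_le_def using h
    by (intro exI[of _ h]) (auto simp: strict_mono_on_def)
  ultimately show thesis by (rule that)
qed

text \<open>\<open>v\<close> consists of the first \<open>card s\<close> elements of
  \<open>t\<close>. Inclusion is thereby reduced to pointwise domination, which is how smooth trees
  come to be closed under subsets and their leaves to form a barrier.\<close>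

lemma subset_pointwise_ge:
  assumes "finite s" "s \<subseteq> t"
  obtains v where "init_seg v t" "v \<preceq> s"
  using assms
proof (induction s arbitrary: thesis rule: finite_linorder_max_induct)
  case empty
  then show ?case using init_seg_empty pointwise_le_refl by blast
next
  case (insert b s)
  obtain v where v: "init_seg v t" "v \<preceq> s" using insert.IH insert.prems by blast
  have fin: "finite v" using v(2) insert.hyps(1) pointwise_le_card
    by (metis card_eq_0_iff finite.emptyI pointwise_le_empty(2))
  \<comment> \<open>If the initial segment \<open>v\<close> contained \<open>b\<close>, it would
    contain all of \<open>insert b s\<close>, although it has only as many elements as
    \<open>s\<close>.\<close>
  have "b \<notin> v"
  proof
    assume "b \<in> v"
    have "x \<in> v" if "x \<in> s" for x
    proof (rule ccontr)
      assume "x \<notin> v"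
      then have "b < x" using v(1) \<open>b \<in> v\<close> insert.prems(2) that unfolding init_seg_def by blast
      then show False using insert.hyps(2) that by (meson less_asym)
    qed
    then have "insert b s \<subseteq> v" using \<open>b \<in> v\<close> by blast
    then have "card (insert b s) \<le> card v" using fin by (rule card_mono[rotated])
    moreover have "b \<notin> s" using insert.hyps(2) by blast
    ultimately show False using v(2) insert.hyps(1) pointwise_le_card by fastforce
  qed
  then have "pinit_seg v t" using v(1) insert.prems(2) by (auto simp: pinit_seg_def)
  then obtain n where n: "\<forall>x\<in>v. x < n" "\<forall>x\<in>t - v. n \<le> x" "init_seg (insert n v) t"
    by (rule pinit_seg_next)
  have "insert n v \<preceq> insert b s"
    using v(2) n insert.hyps(2) insert.prems(2) \<open>b \<notin> v\<close> by (intro pointwise_le_insert) auto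
  then show ?case using n(3) insert.prems(1) by blast
qed

lemma pointwise_le_remove_Min:
  assumes "finite s" "s \<noteq> {}" "s \<preceq> t"
  shows "s - {Min s} \<preceq> t - {Min t}" and "Min s \<le> Min t"
proof -
  obtain h where h: "strict_mono_on s h" "h ` s = t" "\<forall>x\<in>s. x \<le> h x"
    using assms(3) unfolding pointwise_le_def by blast
  have m: "Min s \<in> s" using assms by simp
  have "Min t = h (Min s)"
  proof (rule Min_eqI)
    show "finite t" "h (Min s) \<in> t" using assms(1) m h(2) by auto
    fix y assume "y \<in> t"
    then obtain x where "x \<in> s" "y = h x" using h(2) by blast
    then show "h (Min s) \<le> y"
      using strict_mono_on_leD[OF h(1) m] assms(1) by simp
  qed
  then show "Min s \<le> Min t" using h(3) m by simp
  have "h ` (s - {Min s}) = t - {h (Min s)}"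
    using h(2) m inj_on_image_set_diff[OF strict_mono_on_imp_inj_on[OF h(1)], of s "{Min s}"] by simp
  then show "s - {Min s} \<preceq> t - {Min t}"
    unfolding pointwise_le_def \<open>Min t = h (Min s)\<close>
    using h by (intro exI[of _ h]) (auto simp: strict_mono_on_def)
qed

lemma init_seg_Un: "\<forall>x\<in>s. \<forall>y\<in>t. x < y \<Longrightarrow> init_seg s (s \<union> t)"
  by (auto simp: init_seg_def)

lemma init_segD: "init_seg s x \<Longrightarrow> \<forall>y\<in>s. \<forall>z\<in>x - s. y < z"
  by (auto simp: init_seg_def)

lemma infinite_nat_above:
  assumes "infinite (Y :: nat set)" "finite s"
  obtains m where "m \<in> Y" "n \<le> m" "\<forall>x\<in>s. x < m"
proof -
  obtain m where "m \<in> Y" "Max (insert n s) < m"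
    using assms(1) unfolding infinite_nat_iff_unbounded by blast
  then show thesis using that[of m] assms(2) by simp
qed


section \<open>Ranks of trees of finite sets\<close>

definition children :: "nat set set \<Rightarrow> (nat set \<times> nat set) set" where
  "children T = {(t, s). s \<in> T \<and> t \<in> T \<and> (\<exists>n. (\<forall>x\<in>s. x < n) \<and> t = insert n s)}"

text \<open>A leaf gets rank 0 as the empty supremum, in agreement with \<open>ht_at\<close>; see
  \<open>ht_eq_rk\<close>.\<close>

definition rk :: "nat set set \<Rightarrow> nat set \<Rightarrow> cord" where
  "rk T = wfrec (children T) (\<lambda>h s. Sup {osuc (h t) | t. (t, s) \<in> children T})"

lemma rk_rec:
  assumes "wf (children T)"
  shows "rk T s = Sup {osuc (rk T t) | t. (t, s) \<in> children T}"
proof -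
  have "{osuc (cut (rk T) (children T) s t) | t. (t, s) \<in> children T} =
    {osuc (rk T t) | t. (t, s) \<in> children T}"
    by (intro Collect_cong ex_cong1) (auto simp: cut_apply)
  then show ?thesis
    using def_wfrec[OF rk_def[THEN eq_reflection] assms, of s] by (simp only:)
qed

text \<open>The children of a node are indexed by natural numbers, so the supremum is taken over a
  countable set.\<close>

lemma less_rk_iff:
  assumes "wf (children T)"
  shows "d < rk T s \<longleftrightarrow> s \<in> T \<and> (\<exists>n. (\<forall>x\<in>s. x < n) \<and> insert n s \<in> T \<and> d \<le> rk T (insert n s))"
proof -
  have "{osuc (rk T t) | t. (t, s) \<in> children T} \<subseteq> (\<lambda>n. osuc (rk T (insert n s))) ` UNIV"
    by (auto simp: children_def)
  then have "countable {osuc (rk T t) | t. (t, s) \<in> children T}"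
    by (rule countable_subset) simp
  then have "d < rk T s \<longleftrightarrow> (\<exists>t. (t, s) \<in> children T \<and> d \<le> rk T t)"
    by (subst rk_rec[OF assms]) (auto simp: less_Sup_cord_iff less_osuc_iff)
  then show ?thesis by (auto simp: children_def)
qed

lemma rk_insert_less:
  "wf (children T) \<Longrightarrow> s \<in> T \<Longrightarrow> \<forall>x\<in>s. x < n \<Longrightarrow> insert n s \<in> T \<Longrightarrow> rk T (insert n s) < rk T s"
  using less_rk_iff by blast

lemma wf_children_mono: "wf (children T') \<Longrightarrow> T \<subseteq> T' \<Longrightarrow> wf (children T)"
  by (erule wf_subset) (auto simp: children_def)

text \<open>A potential with finitely many values per node, one for each reason why the node is in
  the tree. Every value at a child is exceeded by some value at the parent, so the maximum drops.
  This yields well-foundedness and the rank bound together, without a canonical choice of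
  reason.\<close>

lemma rk_le_Max:
  assumes fin: "\<And>s. s \<in> T \<Longrightarrow> finite (v s) \<and> v s \<noteq> {}"
    and dec: "\<And>s n x. s \<in> T \<Longrightarrow> \<forall>y\<in>s. y < n \<Longrightarrow> insert n s \<in> T \<Longrightarrow> x \<in> v (insert n s) \<Longrightarrow>
        \<exists>y\<in>v s. x < (y :: cord)"
  shows "wf (children T)" and "s \<in> T \<Longrightarrow> rk T s \<le> Max (v s)"
proof -
  have less: "Max (v (insert n s)) < Max (v s)"
    if "s \<in> T" "\<forall>y\<in>s. y < n" "insert n s \<in> T" for s n
    using that fin dec by (metis Max_ge Max_in less_le_trans)
  show wf: "wf (children T)"
    by (rule wf_subset[OF wf_inv_image[OF wf, of "\<lambda>s. Max (v s)"]])
      (auto simp: children_def less)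
  show "rk T s \<le> Max (v s)" if "s \<in> T"
    using wf that
  proof (induction s rule: wf_induct_rule)
    case (less s)
    show ?case
    proof (rule leI, rule notI)
      assume "Max (v s) < rk T s"
      then obtain n where n: "\<forall>x\<in>s. x < n" "insert n s \<in> T" "Max (v s) \<le> rk T (insert n s)"
        by (auto simp: less_rk_iff[OF wf])
      have "rk T (insert n s) \<le> Max (v (insert n s))"
        using n less.prems by (intro less.IH) (auto simp: children_def)
      then show False using n less.prems \<open>\<And>s n. _ \<Longrightarrow> _ \<Longrightarrow> _ \<Longrightarrow> Max (v (insert n s)) < Max (v s)\<close>
        by (meson leD le_less_trans order_trans)
    qed
  qed
qed


section \<open>Smooth trees\<close>

text \<open>These are exactly the trees of smooth fronts, except that the base \<open>Y\<close> of the tree \<open>{{}}\<close>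
  is arbitrary.  The axiom \<open>extend\<close> says both that membership is preserved by moving a set up
  pointwise, and that a node has either no child or all possible children.\<close>

locale smooth_tree =
  fixes Y :: "nat set" and T :: "nat set set"
  assumes infinite_base: "infinite Y"
    and finite_node: "s \<in> T \<Longrightarrow> finite s"
    and node_subset: "s \<in> T \<Longrightarrow> s \<subseteq> Y"
    and root: "{} \<in> T"
    and parent: "insert n s \<in> T \<Longrightarrow> \<forall>x\<in>s. x < n \<Longrightarrow> s \<in> T"
    and extend: "insert n s \<in> T \<Longrightarrow> \<forall>x\<in>s. x < n \<Longrightarrow> s \<preceq> t \<Longrightarrow> \<forall>x\<in>t. x < m \<Longrightarrow>
      insert m t \<subseteq> Y \<Longrightarrow> insert m t \<in> T"
    and wf: "wf (children T)"
begin

lemma upward: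
  assumes "s \<in> T" "s \<preceq> t" "t \<subseteq> Y"
  shows "t \<in> T"
proof (cases "s = {}")
  case True
  then show ?thesis using assms root by simp
next
  case False
  define n s' where "n = Max s" and "s' = s - {n}"
  have fin: "finite s" using assms(1) by (rule finite_node)
  have s: "s = insert n s'" "\<forall>x\<in>s'. x < n"
    using Max_in[OF fin False] Max_ge[OF fin] unfolding n_def s'_def by (auto simp: le_less)
  obtain m u where "t = insert m u" "\<forall>y\<in>u. y < m" "s' \<preceq> u"
    using pointwise_le_insertE s assms(2) by metis
  then show ?thesis using s assms extend by blast
qed

lemma initial:
  assumes "t \<in> T" "init_seg s t"
  shows "s \<in> T"
  using finite_node[OF assms(1)] assms
proof (induction t rule: finite_linorder_max_induct)
  case (insert b t)
  then show ?case
    by (metis parent pinit_seg_def pinit_seg_insert_iff)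
qed (simp add: init_seg_def)

text \<open>A child of \<open>s\<close> is matched by a child of \<open>t\<close> whose last point
  is at least as large and lies beyond \<open>t\<close>; such a point exists since \<open>Y\<close>
  is infinite.\<close>

lemma rk_pointwise_mono:
  assumes "s \<in> T" "s \<preceq> t" "t \<subseteq> Y"
  shows "rk T s \<le> rk T t"
  using wf assms
proof (induction s arbitrary: t rule: wf_induct_rule)
  case (less s)
  show ?case
  proof (rule leI, rule notI)
    assume "rk T t < rk T s"
    then obtain n where n: "\<forall>x\<in>s. x < n" "insert n s \<in> T" "rk T t \<le> rk T (insert n s)"
      by (auto simp: less_rk_iff[OF wf])
    have t: "t \<in> T" using less.prems by (rule upward)
    obtain m where m: "m \<in> Y" "n \<le> m" "\<forall>x\<in>t. x < m"
      by (rule infinite_nat_above[OF infinite_base finite_node[OF t]])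
    have le: "insert n s \<preceq> insert m t" using less.prems(2) n(1) m(3,2) by (rule pointwise_le_insert)
    have sub: "insert m t \<subseteq> Y" using m less.prems by simp
    have "rk T (insert n s) \<le> rk T (insert m t)"
      using n less.prems le sub by (intro less.IH) (auto simp: children_def)
    also have "\<dots> < rk T t"
      using t m upward[OF n(2) le sub] by (intro rk_insert_less[OF wf]) auto
    finally show False using n(3) by simp
  qed
qed

text \<open>By \<open>rk_pointwise_mono\<close> the next point can be moved beyond all of
  \<open>p \<union> t\<close> without losing rank, so a fixed prefix costs nothing.\<close>

lemma rk_prefix:
  assumes T': "wf (children T')" and p: "finite p"
    and sub: "\<And>t. t \<in> T \<Longrightarrow> \<forall>x\<in>p. \<forall>y\<in>t. x < y \<Longrightarrow> p \<union> t \<in> T'"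
    and "t \<in> T" "\<forall>x\<in>p. \<forall>y\<in>t. x < y"
  shows "rk T t \<le> rk T' (p \<union> t)"
  using wf assms(4-)
proof (induction t rule: wf_induct_rule)
  case (less t)
  show ?case
  proof (rule leI, rule notI)
    assume "rk T' (p \<union> t) < rk T t"
    then obtain n where n: "\<forall>x\<in>t. x < n" "insert n t \<in> T" "rk T' (p \<union> t) \<le> rk T (insert n t)"
      by (auto simp: less_rk_iff[OF wf])
    have "finite (p \<union> t)" using p finite_node less.prems by simp
    then obtain m where m: "m \<in> Y" "n \<le> m" "\<forall>x\<in>p \<union> t. x < m"
      by (rule infinite_nat_above[OF infinite_base])
    have le: "insert n t \<preceq> insert m t" using n(1) m by (intro pointwise_le_insert) auto
    have Y: "insert m t \<subseteq> Y" using m less.prems node_subset by simp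
    have mt: "insert m t \<in> T" using n(2) le Y by (rule upward)
    have pm: "\<forall>x\<in>p. \<forall>y\<in>insert m t. x < y" using less.prems m by auto
    have "rk T (insert n t) \<le> rk T (insert m t)" using n(2) le Y by (rule rk_pointwise_mono)
    also have "\<dots> \<le> rk T' (p \<union> insert m t)"
      using n m less.prems mt pm by (intro less.IH) (auto simp: children_def)
    also have "\<dots> < rk T' (p \<union> t)"
      using rk_insert_less[OF T' sub[OF less.prems] m(3)] sub[OF mt pm] by simp
    finally show False using n(3) by simp
  qed
qed

lemma rk_mono:
  assumes "wf (children T')" "T \<subseteq> T'" "t \<in> T"
  shows "rk T t \<le> rk T' t"
  using rk_prefix[of T' "{}" t] assms by auto

end

section \<open>Leaves: from smooth trees to smooth barriers and back\<close>

definition leaves :: "nat set set \<Rightarrow> nat set set" where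
  "leaves T = {s \<in> T. \<forall>n. (\<forall>x\<in>s. x < n) \<longrightarrow> insert n s \<notin> T}"

lemma smooth_tree_trivial: "infinite Y \<Longrightarrow> smooth_tree Y {{}}"
proof unfold_locales
  have "children {{}} = {}" by (auto simp: children_def)
  then show "wf (children {{}})" by simp
qed auto

lemma leaves_trivial [simp]: "leaves {{}} = {{}}"
  by (auto simp: leaves_def)

context smooth_tree
begin

lemma rk_leaf: "s \<in> leaves T \<Longrightarrow> rk T s = 0"
proof -
  assume "s \<in> leaves T"
  then have "\<not> 0 < rk T s" unfolding less_rk_iff[OF wf] by (auto simp: leaves_def)
  then show ?thesis using zero_le_cord[of "rk T s"] by (simp add: less_le)
qed

lemma trivial_if_root_leaf: "{} \<in> leaves T \<Longrightarrow> T = {{}}"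
proof -
  assume "{} \<in> leaves T"
  then have no: "{n} \<notin> T" for n by (simp add: leaves_def)
  have "s = {}" if "s \<in> T" for s
  proof (rule ccontr)
    assume "s \<noteq> {}"
    then have "pinit_seg {} s" by (simp add: pinit_seg_def)
    then obtain n where "init_seg (insert n {}) s" by (rule pinit_seg_next)
    then show False using no initial that by blast
  qed
  then show ?thesis using root by blast
qed

lemma leaf_no_pinit_seg: "s \<in> leaves T \<Longrightarrow> t \<in> T \<Longrightarrow> \<not> pinit_seg s t"
proof
  assume s: "s \<in> leaves T" "t \<in> T" and "pinit_seg s t"
  then obtain n where "\<forall>x\<in>s. x < n" "init_seg (insert n s) t" by (metis pinit_seg_next)
  then show False using s initial by (auto simp: leaves_def)
qed

text \<open>The branch through \<open>X\<close> stops by well-foundedness. It stops at a leaf: by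
  \<open>extend\<close>, a node with any child also has the child given by the next point of
  \<open>X\<close>.\<close>

lemma leaf_above:
  assumes s: "s \<in> T" and X: "infinite X" "X \<subseteq> Y" "init_seg s X"
  obtains l where "l \<in> leaves T" "init_seg s l" "pinit_seg l X"
proof -
  let ?Q = "{u \<in> T. init_seg s u \<and> init_seg u X}"
  obtain u where u: "u \<in> ?Q" "\<And>v. (v, u) \<in> children T \<Longrightarrow> v \<notin> ?Q"
    using wfE_min[OF wf, of s ?Q] s X by auto
  have "u \<noteq> X" using u(1) X(1) finite_node by blast
  then have pX: "pinit_seg u X" using u(1) by (simp add: pinit_seg_def)
  then obtain m where m: "m \<in> X" "\<forall>x\<in>u. x < m" "init_seg (insert m u) X"
    by (rule pinit_seg_next)
  have "u \<in> leaves T"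
  proof (rule ccontr)
    assume "u \<notin> leaves T"
    then obtain n where n: "\<forall>x\<in>u. x < n" "insert n u \<in> T" using u(1) by (auto simp: leaves_def)
    have "insert m u \<subseteq> Y" using m(1) X(2) u(1) node_subset by auto
    then have mu: "insert m u \<in> T" by (rule extend[OF n(2,1) pointwise_le_refl m(2)])
    moreover have "init_seg s (insert m u)"
      using init_seg_trans[OF _ init_seg_insert[OF m(2)], of s] u(1) by simp
    moreover have "(insert m u, u) \<in> children T" using u(1) mu m(2) by (auto simp: children_def)
    ultimately show False using u(2) m(3) by simp
  qed
  then show thesis using that[OF _ _ pX] u(1) by simp
qed

lemma init_seg_final: "init_seg s (s \<union> {m \<in> Y. \<forall>x\<in>s. x < m})"
  by (auto simp: init_seg_def)

lemma infinite_final: "infinite (s \<union> {m \<in> Y. \<forall>x\<in>s. x < m})"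
proof
  assume "finite (s \<union> {m \<in> Y. \<forall>x\<in>s. x < m})"
  then obtain m where "m \<in> Y" "\<forall>x\<in>s \<union> {m \<in> Y. \<forall>x\<in>s. x < m}. x < m"
    by (rule infinite_nat_above[OF infinite_base])
  then show False by blast
qed

lemma in_tree_or_leaf_below:
  assumes "finite s" "s \<subseteq> Y"
  shows "s \<in> T \<or> (\<exists>l\<in>leaves T. pinit_seg l s)"
proof -
  let ?X = "s \<union> {m \<in> Y. \<forall>x\<in>s. x < m}"
  obtain l where l: "l \<in> leaves T" "pinit_seg l ?X"
    by (rule leaf_above[OF root infinite_final]) (use assms(2) in auto)
  then have "init_seg s l \<or> pinit_seg l s"
    using init_seg_comparable init_seg_final unfolding pinit_seg_def by blast
  then show ?thesis using l(1) initial by (auto simp: leaves_def)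
qed

text \<open>The hypothesis concerns the trivial tree, which is a smooth tree over any infinite
  \<open>Y\<close>, whereas the degenerate front always has base \<open>UNIV\<close>. It recurs
  wherever leaves are read as a front.\<close>

lemma base_leaves: "(T = {{}} \<Longrightarrow> Y = UNIV) \<Longrightarrow> base (leaves T) = Y"
proof (cases "T = {{}}")
  case False
  then have ne: "{} \<notin> leaves T" using trivial_if_root_leaf by blast
  then have "leaves T \<noteq> {{}}" by blast
  obtain m where m: "{m} \<in> T" using ne root by (auto simp: leaves_def)
  have "n \<in> \<Union>(leaves T)" if n: "n \<in> Y" for n
  proof -
    have "{n} \<in> T" using extend[of m "{}" "{}" n] m n by simp
    moreover have "infinite ({n} \<union> {m \<in> Y. \<forall>x\<in>{n}. x < m})" by (rule infinite_final)
    ultimately obtain l where "l \<in> leaves T" "init_seg {n} l"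
      by (rule leaf_above[OF _ _ _ init_seg_final]) (use n in auto)
    then show ?thesis unfolding init_seg_def by blast
  qed
  moreover have "\<Union>(leaves T) \<subseteq> Y" using node_subset by (auto simp: leaves_def)
  ultimately show ?thesis using \<open>leaves T \<noteq> {{}}\<close> by (auto simp: base_def)
qed (simp add: base_def)

text \<open>The proper initial segment \<open>v\<close> of a node has a child, and
  \<open>extend\<close> would hand a child on to the leaf \<open>s\<close> that dominates
  \<open>v\<close>. Smoothness and the barrier property of the leaves both reduce to this
  contradiction.\<close>

lemma leaf_no_larger_node:
  assumes "s \<in> leaves T" "t \<in> T" "init_seg v t" "v \<noteq> t" "v \<preceq> s"
  shows False
proof -
  obtain n where n: "\<forall>x\<in>v. x < n" "init_seg (insert n v) t"
    by (rule pinit_seg_next[of v t]) (use assms in \<open>simp add: pinit_seg_def\<close>)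
  then have v: "insert n v \<in> T" using assms(2) initial by blast
  have s: "s \<in> T" using assms(1) by (simp add: leaves_def)
  obtain m where m: "m \<in> Y" "\<forall>x\<in>s. x < m"
    by (rule infinite_nat_above[OF infinite_base finite_node[OF s]])
  have "insert m s \<in> T" using v n(1) assms(5) m node_subset[OF s] by (simp add: extend[OF v n(1)])
  then show False using assms(1) m by (simp add: leaves_def)
qed

lemma smooth_leaves: "smooth (leaves T)"
  unfolding smooth_def
proof (intro ballI impI, rule ccontr)
  fix s t assume st: "s \<in> leaves T" "t \<in> leaves T" "card s < card t"
    and neg: "\<not> (\<exists>i<card s. sorted_list_of_set s ! i < sorted_list_of_set t ! i)"
  have T: "s \<in> T" "t \<in> T" using st by (auto simp: leaves_def)
  then have fin: "finite s" "finite t" by (auto intro: finite_node)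
  define xs where "xs = sorted_list_of_set t"
  have xs: "sorted_wrt (<) xs" "set xs = t" "length xs = card t" using fin by (simp_all add: xs_def)
  have le: "xs ! i \<le> sorted_list_of_set s ! i" if "i < card s" for i
    using neg that unfolding xs_def by (meson not_less)
  \<comment> \<open>The first \<open>card s\<close> elements of \<open>t\<close>; the failure of
    smoothness says that they lie pointwise below \<open>s\<close>.\<close>
  define v where "v = set (take (card s) xs)"
  have "v \<preceq> set (sorted_list_of_set s)"
    unfolding v_def
    by (rule pointwise_le_sorted_lists)
      (use st xs(1,3) le in \<open>auto simp: sorted_wrt_take\<close>)
  then have "v \<preceq> s" using fin by simp
  moreover have "init_seg v t"
    using init_seg_take[OF xs(1)] by (simp add: v_def xs(2))
  moreover have "v \<noteq> t" using pointwise_le_card[OF \<open>v \<preceq> s\<close>] st(3) by auto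
  ultimately show False using leaf_no_larger_node st(1) T(2) by blast
qed

lemma front_leaves:
  assumes "T = {{}} \<Longrightarrow> Y = UNIV"
  shows "front (leaves T)"
proof (cases "T = {{}}")
  case False
  have "\<exists>s\<in>leaves T. pinit_seg s X" if "infinite X" "X \<subseteq> Y" for X
    using leaf_above[OF root that] by auto
  moreover have "\<not> (\<exists>s\<in>leaves T. \<exists>t\<in>leaves T. pinit_seg s t)"
    using leaf_no_pinit_seg by (auto simp: leaves_def)
  moreover have "\<forall>s\<in>leaves T. finite s" using finite_node by (auto simp: leaves_def)
  ultimately show ?thesis using infinite_base base_leaves[OF assms] by (simp add: front_def)
qed (simp add: front_def)

lemma smooth_barrier_leaves:
  assumes "T = {{}} \<Longrightarrow> Y = UNIV"
  shows "smooth_barrier (leaves T)"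
proof -
  have "\<not> s \<subset> t" if st: "s \<in> leaves T" "t \<in> leaves T" for s t
  proof
    assume "s \<subset> t"
    have T: "s \<in> T" "t \<in> T" using st by (auto simp: leaves_def)
    obtain v where v: "init_seg v t" "v \<preceq> s"
      by (rule subset_pointwise_ge[OF finite_node[OF T(1)] psubset_imp_subset[OF \<open>s \<subset> t\<close>]])
    have "v \<noteq> t"
      using pointwise_le_card[OF v(2)] psubset_card_mono[OF finite_node[OF T(2)] \<open>s \<subset> t\<close>] by auto
    then show False using leaf_no_larger_node[OF st(1) T(2) v(1)] v(2) by blast
  qed
  then show ?thesis
    unfolding smooth_barrier_def barrier_def using front_leaves[OF assms] smooth_leaves by blast
qed

lemma front_tree_leaves:
  assumes "T = {{}} \<Longrightarrow> Y = UNIV"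
  shows "front_tree (leaves T) = T"
proof (intro set_eqI iffI)
  fix s assume "s \<in> front_tree (leaves T)"
  then show "s \<in> T" using in_tree_or_leaf_below[of s] by (simp add: front_tree_def base_leaves[OF assms])
next
  fix s assume s: "s \<in> T"
  then have "\<not> (\<exists>u\<in>leaves T. pinit_seg u s)" using leaf_no_pinit_seg by blast
  then show "s \<in> front_tree (leaves T)"
    using finite_node[OF s] node_subset[OF s] by (simp add: front_tree_def base_leaves[OF assms])
qed

end

lemma tree_child_eq: "tree_child B = children (front_tree B)"
  by (simp add: tree_child_def children_def)

lemma ht_eq_rk:
  assumes "front B"
  shows "ht B = rk (front_tree B) {}"
proof -
  have wf: "wf (children (front_tree B))" using wf_tree_child[OF assms] by (simp add: tree_child_eq)
  have "ht_at B s = rk (front_tree B) s" for s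
    using wf
  proof (induction s rule: wf_induct_rule)
    case (less s)
    have eq: "{osuc (ht_at B t) | t. (t, s) \<in> children (front_tree B)} =
        {osuc (rk (front_tree B) t) | t. (t, s) \<in> children (front_tree B)}"
      using less by (intro Collect_cong ex_cong1) auto
    show ?case
    proof (cases "s \<in> B")
      case True
      \<comment> \<open>Elements of the front have no children in the tree, so the recursion for
        \<open>rk\<close> gives them 0 as well.\<close>
      have "(t, s) \<notin> children (front_tree B)" for t
        using True pinit_seg_insert[of s] by (fastforce simp: children_def front_tree_def)
      then have "rk (front_tree B) s = Sup {}" by (subst rk_rec[OF wf]) simp
      also have "\<dots> = 0" using Sup_cord_least[of "{}" 0] by (simp add: antisym)
      finally show ?thesis using True by (subst ht_at_rec[OF assms]) simp
    next
      case False
      then show ?thesis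
        by (subst ht_at_rec[OF assms], subst rk_rec[OF wf]) (simp add: tree_child_eq eq)
    qed
  qed
  then show ?thesis by (simp add: ht_def)
qed

lemma (in smooth_tree) ht_leaves: "(T = {{}} \<Longrightarrow> Y = UNIV) \<Longrightarrow> ht (leaves T) = rk T {}"
  by (simp add: ht_eq_rk front_leaves front_tree_leaves)

lemma front_infinite_base: "front B \<Longrightarrow> infinite (base B)"
  by (cases "B = {{}}") (simp_all add: front_def, simp add: base_def)

lemma front_finite: "front B \<Longrightarrow> s \<in> B \<Longrightarrow> finite s"
  by (simp add: front_def)

lemma front_subset_base: "s \<in> B \<Longrightarrow> s \<subseteq> base B"
  by (auto simp: base_def)

lemma front_no_pinit_seg: "front B \<Longrightarrow> s \<in> B \<Longrightarrow> t \<in> B \<Longrightarrow> \<not> pinit_seg s t"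
  by (auto simp: front_def pinit_seg_def)

lemma front_subset_front_tree: "front B \<Longrightarrow> B \<subseteq> front_tree B"
  using front_finite front_subset_base front_no_pinit_seg unfolding front_tree_def by blast

lemma insert_in_front_tree_iff:
  assumes "\<forall>x\<in>s. x < n"
  shows "insert n s \<in> front_tree B \<longleftrightarrow> s \<in> front_tree B \<and> s \<notin> B \<and> n \<in> base B"
proof -
  have "(\<exists>u\<in>B. init_seg u s) \<longleftrightarrow> s \<in> B \<or> (\<exists>u\<in>B. pinit_seg u s)"
    using init_seg_refl by (auto simp: pinit_seg_def simp del: init_seg_refl)
  then show ?thesis unfolding front_tree_def by (auto simp: pinit_seg_insert_iff[OF assms])
qed

lemma leaves_front_tree:
  assumes "front B"
  shows "leaves (front_tree B) = B"
proof -
  have "s \<in> B" if "s \<in> leaves (front_tree B)" for s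
  proof -
    have s: "s \<in> front_tree B" using that by (simp add: leaves_def)
    then have "finite s" by (simp add: front_tree_def)
    then obtain n where "n \<in> base B" "\<forall>x\<in>s. x < n"
      by (rule infinite_nat_above[OF front_infinite_base[OF assms]])
    then show ?thesis using that s by (auto simp: leaves_def insert_in_front_tree_iff)
  qed
  moreover have "s \<in> leaves (front_tree B)" if "s \<in> B" for s
    using that front_subset_front_tree[OF assms] by (auto simp: leaves_def insert_in_front_tree_iff)
  ultimately show ?thesis by blast
qed

text \<open>The front property is applied to \<open>s\<close> followed by all later points of the
  base; the element found cannot stop before \<open>s\<close> ends, because \<open>s\<close> is in
  the tree.\<close>

lemma front_tree_extend:
  assumes "front B" "s \<in> front_tree B"
  obtains w where "w \<in> B" "init_seg s w"
proof (cases "B = {{}}")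
  case True
  then have "s = {}" using assms(2) by (auto simp: front_tree_def pinit_seg_def)
  then show thesis using True that by simp
next
  case False
  let ?X = "s \<union> {m \<in> base B. \<forall>x\<in>s. x < m}"
  have s: "finite s" "s \<subseteq> base B" using assms(2) by (auto simp: front_tree_def)
  have "infinite ?X"
  proof
    assume "finite ?X"
    then obtain m where "m \<in> base B" "\<forall>x\<in>?X. x < m"
      by (rule infinite_nat_above[OF front_infinite_base[OF assms(1)]])
    then show False by blast
  qed
  moreover have "?X \<subseteq> base B" using s by auto
  ultimately obtain w where w: "w \<in> B" "pinit_seg w ?X" using assms(1) False unfolding front_def by metis
  moreover have "init_seg s ?X" by (auto simp: init_seg_def)
  ultimately have "init_seg s w" using init_seg_comparable[of s ?X w] assms(2)
    unfolding front_tree_def pinit_seg_def by blast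
  then show thesis using w that by blast
qed

lemma sorted_list_init_seg:
  assumes "init_seg v w" "finite w" "i < card v"
  shows "sorted_list_of_set w ! i = sorted_list_of_set v ! i"
proof -
  have fin: "finite v" using assms(1,2) by (auto simp: init_seg_def intro: finite_subset)
  have "sorted_list_of_set w = sorted_list_of_set v @ sorted_list_of_set (w - v)"
    by (rule strict_sorted_equal)
      (use assms(1,2) fin in \<open>auto simp: sorted_wrt_append init_seg_def\<close>)
  then show ?thesis using assms(3) fin by (simp add: nth_append)
qed

text \<open>For \<open>extend\<close>, suppose that an element \<open>u\<close> of \<open>B\<close>
  is already reached inside \<open>t\<close>. The part \<open>v\<close> of \<open>s\<close>
  corresponding to \<open>u\<close> continues through \<open>s\<close> to a longer \<open>w\<close>
  in \<open>B\<close>. Smoothness makes some entry of \<open>w\<close> exceed that of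
  \<open>u\<close>, but in these places \<open>w\<close> agrees with \<open>v\<close>, which lies
  pointwise below \<open>u\<close>.\<close>

lemma smooth_tree_front_tree:
  assumes "front B" "smooth B"
  shows "smooth_tree (base B) (front_tree B)"
proof
  show "infinite (base B)" using assms(1) by (rule front_infinite_base)
  show "wf (children (front_tree B))" using wf_tree_child[OF assms(1)] by (simp add: tree_child_eq)
  show "{} \<in> front_tree B" by (auto simp: front_tree_def pinit_seg_def init_seg_def)
  fix s t n m assume ns: "insert n s \<in> front_tree B" "\<forall>x\<in>s. x < n"
    and st: "s \<preceq> t" and mt: "\<forall>x\<in>t. x < m" "insert m t \<subseteq> base B"
  have s: "s \<in> front_tree B" "s \<notin> B" using ns by (auto simp: insert_in_front_tree_iff)
  have fin: "finite s" using s by (simp add: front_tree_def)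
  show "insert m t \<in> front_tree B"
  proof (rule ccontr)
    assume "insert m t \<notin> front_tree B"
    moreover have "finite (insert m t)" using st fin pointwise_le_finite by simp
    ultimately obtain u where u: "u \<in> B" "init_seg u t"
      using mt by (auto simp: front_tree_def pinit_seg_insert_iff)
    obtain v where v: "init_seg v s" "v \<preceq> u" by (rule pointwise_le_split[OF fin st u(2)])
    obtain w where w: "w \<in> B" "init_seg s w" using assms(1) s(1) by (rule front_tree_extend)
    have finw: "finite w" using assms(1) w(1) by (rule front_finite)
    have vw: "init_seg v w" using v(1) w(2) by (rule init_seg_trans)
    have finv: "finite v" using v(1) fin by (auto simp: init_seg_def intro: finite_subset)
    have "card v \<le> card s" using v(1) fin by (rule init_seg_card)
    also have "card s < card w" using w s(2) finw by (intro pinit_seg_card) (auto simp: pinit_seg_def)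
    finally have "card u < card w" using v(2) pointwise_le_card by simp
    then obtain i where i: "i < card u" "sorted_list_of_set u ! i < sorted_list_of_set w ! i"
      using assms(2) u(1) w(1) unfolding smooth_def by blast
    have "i < card v" using i(1) v(2) pointwise_le_card by simp
    then have "sorted_list_of_set w ! i \<le> sorted_list_of_set u ! i"
      using sorted_list_init_seg[OF vw finw] pointwise_le_nth[OF v(2) finv] by simp
    with i(2) show False by simp
  qed
qed (auto simp: insert_in_front_tree_iff, auto simp: front_tree_def)

lemma smooth_barrier_front: "smooth_barrier B \<Longrightarrow> front B"
  by (simp add: smooth_barrier_def barrier_def)

lemma smooth_barrier_tree: "smooth_barrier B \<Longrightarrow> smooth_tree (base B) (front_tree B)"
  by (simp add: smooth_barrier_def barrier_def smooth_tree_front_tree)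

context smooth_tree
begin

lemma subset_node:
  assumes "t \<in> T" "s \<subseteq> t"
  shows "s \<in> T"
proof -
  have "finite s" using assms finite_node finite_subset by blast
  then obtain v where "init_seg v t" "v \<preceq> s" using assms(2) by (rule subset_pointwise_ge)
  then show ?thesis using upward[OF initial] assms node_subset by blast
qed

lemma rk_descendant:
  assumes "t \<in> T" "init_seg s t"
  shows "rk T t \<le> rk T s"
  using finite_node[OF assms(1)] assms
proof (induction t rule: finite_linorder_max_induct)
  case (insert b t)
  show ?case
  proof (cases "s = insert b t")
    case False
    then have st: "init_seg s t"
      using insert.prems(2) insert.hyps(2) by (metis pinit_seg_def pinit_seg_insert_iff)
    have "t \<in> T" using insert.prems(1) insert.hyps(2) by (rule parent)
    moreover have "rk T (insert b t) < rk T t"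
      by (rule rk_insert_less[OF wf \<open>t \<in> T\<close> insert.hyps(2) insert.prems(1)])
    ultimately show ?thesis using insert.IH st by fastforce
  qed simp
qed (simp add: init_seg_def)

lemma trivial_if_rk_root: "rk T {} = 0 \<Longrightarrow> T = {{}}"
proof (rule trivial_if_root_leaf)
  assume "rk T {} = 0"
  then have "\<not> 0 < rk T {}" by simp
  then show "{} \<in> leaves T" using root unfolding less_rk_iff[OF wf] by (auto simp: leaves_def)
qed

lemma leaf_unique:
  assumes "s \<in> leaves T" "t \<in> leaves T" "init_seg s x" "init_seg t x"
  shows "s = t"
  using init_seg_comparable[OF assms(3,4)] leaf_no_pinit_seg[of s t] leaf_no_pinit_seg[of t s] assms
  by (auto simp: leaves_def pinit_seg_def)

end

lemma rk_trivial [simp]: "rk {{}} {} = 0"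
  using smooth_tree.rk_leaf[OF smooth_tree_trivial, of UNIV "{}"] by simp

section \<open>Constructions of smooth trees\<close>

lemma smooth_tree_restrict:
  assumes "smooth_tree Y T" "infinite Z" "Z \<subseteq> Y"
  shows "smooth_tree Z (T \<inter> Pow Z)" and "rk (T \<inter> Pow Z) {} \<le> rk T {}"
proof -
  interpret smooth_tree Y T by fact
  show Z: "smooth_tree Z (T \<inter> Pow Z)"
  proof
    show "wf (children (T \<inter> Pow Z))" using wf by (rule wf_children_mono) simp
    show "insert m t \<in> T \<inter> Pow Z"
      if "insert n s \<in> T \<inter> Pow Z" "\<forall>x\<in>s. x < n" "s \<preceq> t" "\<forall>x\<in>t. x < m" "insert m t \<subseteq> Z" for n s m t
      using that extend[of n s t m] assms(3) by blast
  qed (use assms(2) finite_node root parent in auto)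
  show "rk (T \<inter> Pow Z) {} \<le> rk T {}"
    using smooth_tree.rk_mono[OF Z wf] root by simp
qed

text \<open>A node common to both trees carries two ranks, whose maximum bounds its rank in the
  union. This serves to raise the rank of a majorant to a prescribed value.\<close>

lemma smooth_tree_Un:
  assumes "smooth_tree Y T" "smooth_tree Y T'" "rk T {} \<le> rk T' {}"
  shows "smooth_tree Y (T \<union> T')" and "rk (T \<union> T') {} = rk T' {}"
proof -
  interpret T: smooth_tree Y T by fact
  interpret T': smooth_tree Y T' by fact
  define v where "v s = (if s \<in> T then {rk T s} else {}) \<union> (if s \<in> T' then {rk T' s} else {})" for s
  have v: "finite (v s) \<and> v s \<noteq> {}" if "s \<in> T \<union> T'" for s
    using that by (auto simp: v_def)
  have dec: "\<exists>y\<in>v s. x < y" if "\<forall>y\<in>s. y < n" "x \<in> v (insert n s)" for s n x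
    using that T.parent[of n s] T'.parent[of n s] rk_insert_less[OF T.wf, of s n] rk_insert_less[OF T'.wf, of s n]
    by (auto simp: v_def split: if_splits)
  have wf: "wf (children (T \<union> T'))"
    by (rule rk_le_Max(1)[of "T \<union> T'" v]) (use v dec in auto)
  show "smooth_tree Y (T \<union> T')"
  proof
    show "insert m t \<in> T \<union> T'"
      if "insert n s \<in> T \<union> T'" "\<forall>x\<in>s. x < n" "s \<preceq> t" "\<forall>x\<in>t. x < m" "insert m t \<subseteq> Y" for n s m t
      using that T.extend[of n s t m] T'.extend[of n s t m] by blast
    show "s \<subseteq> Y" if "s \<in> T \<union> T'" for s
      using that T.node_subset T'.node_subset by blast
  qed (use wf T.infinite_base T.finite_node T'.finite_node T.root T.parent T'.parent in auto)
  have "rk (T \<union> T') {} \<le> Max (v {})"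
    by (rule rk_le_Max(2)[of "T \<union> T'" v]) (use v dec T.root in auto)
  also have "\<dots> = rk T' {}" using assms(3) T.root T'.root by (simp add: v_def)
  finally show "rk (T \<union> T') {} = rk T' {}"
    using T'.rk_mono[OF wf] T'.root by (simp add: antisym)
qed

lemma smooth_tree_of_rk:
  assumes Y: "infinite Y"
  shows "\<exists>T. smooth_tree Y T \<and> rk T {} = a"
proof (induction a rule: less_induct)
  case (less a)
  show ?case
  proof (cases "a = 0")
    case True
    then show ?thesis using smooth_tree_trivial[OF Y] by (intro exI[of _ "{{}}"]) simp
  next
    case False
    then have ne: "{..<a} \<noteq> {}" using zero_le_cord[of a] by (auto simp: le_less)
    define r where "r = from_nat_into {..<a}"
    have r: "r j < a" for j using from_nat_into[OF ne] by (simp add: r_def)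
    have surj: "\<exists>j. d = r j" if "d < a" for d
      using from_nat_into_surj[OF countable_lessThan_cord, of d a] that by (auto simp: r_def)
    have "\<forall>j. \<exists>U. smooth_tree Y U \<and> rk U {} = r j" using less r by blast
    then obtain U where U: "\<And>j. smooth_tree Y (U j)" "\<And>j. rk (U j) {} = r j" by metis
    \<comment> \<open>A node with least element \<open>n\<close> continues in one of
      \<open>U 0\<close>, ..., \<open>U n\<close>. Having finitely many of them keeps the rank of
      \<open>{n}\<close> below \<open>a\<close>; the condition \<open>j \<le> Min t\<close> survives
      when the minimum moves up; and every \<open>U j\<close> occurs above all large
      \<open>n\<close> in \<open>Y\<close>, so the ranks of the \<open>{n}\<close> reach or exceed
      each ordinal below \<open>a\<close>.\<close>
    define T where "T = {t. t = {} \<or> Min t \<in> Y \<and> (\<exists>j\<le>Min t. t - {Min t} \<in> U j)}"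
    define v where "v t = (if t = {} then {a} else
      (\<lambda>j. rk (U j) (t - {Min t})) ` {j. j \<le> Min t \<and> t - {Min t} \<in> U j})" for t
    have fin: "finite t" if t: "t \<in> T" for t
    proof (cases "t = {}")
      case False
      then obtain j where "t - {Min t} \<in> U j" using t by (auto simp: T_def)
      then have "finite (t - {Min t})" using smooth_tree.finite_node[OF U(1)] by blast
      then show ?thesis by simp
    qed simp
    have Min: "Min (insert n t) = Min t" "insert n t - {Min t} = insert n (t - {Min t})"
      "\<forall>y\<in>t - {Min t}. y < n"
      if "\<forall>y\<in>t. y < n" "t \<noteq> {}" "finite t" for n t
    proof -
      have m: "Min t \<in> t" using that by simp
      then have lt: "Min t < n" using that(1) by blast
      show "Min (insert n t) = Min t"
        using Min_insert[OF that(3,2), of n] less_imp_le[OF lt] by (simp only: min_absorb2)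
      show "insert n t - {Min t} = insert n (t - {Min t})" using m that(1) by blast
      show "\<forall>y\<in>t - {Min t}. y < n" using that(1) by blast
    qed
    have v: "finite (v t) \<and> v t \<noteq> {}" if "t \<in> T" for t
      using that by (auto simp: v_def T_def)
    have dec: "\<exists>y\<in>v t. x < y" if t: "\<forall>y\<in>t. y < n" "insert n t \<in> T" "x \<in> v (insert n t)" for t n x
    proof (cases "t = {}")
      case True
      then show ?thesis using that r U(2) by (auto simp: v_def)
    next
      case False
      note M = Min[OF t(1) False] fin[OF t(2)]
      have ft: "finite t" using fin[OF t(2)] by simp
      obtain j where j: "j \<le> Min t" "insert n (t - {Min t}) \<in> U j" "x = rk (U j) (insert n (t - {Min t}))"
        using t(3) M ft by (auto simp: v_def)
      have "t - {Min t} \<in> U j" using smooth_tree.parent[OF U(1) j(2)] M ft by blast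
      moreover from this have "x < rk (U j) (t - {Min t})"
        using rk_insert_less[OF smooth_tree.wf[OF U(1)]] j(2,3) M ft by blast
      ultimately show ?thesis using j(1) False by (auto simp: v_def)
    qed
    have wf: "wf (children T)"
      by (rule rk_le_Max(1)[of T v]) (use v dec in auto)
    have T: "smooth_tree Y T"
    proof
      show "s \<subseteq> Y" if s: "s \<in> T" for s
      proof (cases "s = {}")
        case False
        then obtain j where "Min s \<in> Y" "s - {Min s} \<in> U j" using s by (auto simp: T_def)
        then show ?thesis using smooth_tree.node_subset[OF U(1)] by blast
      qed simp
      show "s \<in> T" if s: "insert n s \<in> T" "\<forall>x\<in>s. x < n" for n s
      proof (cases "s = {}")
        case False
        have fs: "finite s" using fin[OF s(1)] by simp
        note M = Min[OF s(2) False fs]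
        show ?thesis using s(1) M smooth_tree.parent[OF U(1), of n "s - {Min s}"] by (auto simp: T_def)
      qed (simp add: T_def)
      show "insert m t \<in> T"
        if h: "insert n s \<in> T" "\<forall>x\<in>s. x < n" "s \<preceq> t" "\<forall>x\<in>t. x < m" "insert m t \<subseteq> Y" for n s m t
      proof (cases "s = {}")
        case True
        then show ?thesis using h smooth_tree.root[OF U(1)] by (auto simp: T_def)
      next
        case False
        have fs: "finite s" using fin[OF h(1)] by simp
        have ft: "finite t" using pointwise_le_finite[OF h(3) fs] .
        have tne: "t \<noteq> {}" using h(3) False by auto
        note Ms = Min[OF h(2) False fs] and Mt = Min[OF h(4) tne ft]
        note le = pointwise_le_remove_Min[OF fs False h(3)]
        obtain j where j: "j \<le> Min s" "insert n (s - {Min s}) \<in> U j" using h(1) Ms by (auto simp: T_def)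
        have "insert m (t - {Min t}) \<in> U j"
          using smooth_tree.extend[OF U(1) j(2) Ms(3) le(1) Mt(3)] h(5) by blast
        moreover have "Min t \<in> Y" using h(5) Min_in[OF ft tne] by blast
        moreover have "j \<le> Min t" using j(1) le(2) by simp
        ultimately show ?thesis unfolding T_def mem_Collect_eq Mt(1,2) by blast
      qed
      show "{} \<in> T" by (simp add: T_def)
    qed (fact Y fin wf)+
    have "rk T {} \<le> Max (v {})"
      by (rule rk_le_Max(2)[of T v]) (use v dec smooth_tree.root[OF T] in auto)
    then have "rk T {} \<le> a" by (simp add: v_def)
    moreover have "\<not> rk T {} < a"
    proof
      assume "rk T {} < a"
      then obtain j where j: "rk T {} = r j" using surj by blast
      obtain n where n: "n \<in> Y" "j \<le> n" using infinite_nat_above[OF Y, of "{}"] by blast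
      have "{n} \<union> t \<in> T" if t: "t \<in> U j" "\<forall>x\<in>{n}. \<forall>y\<in>t. x < y" for t
      proof -
        have "Min ({n} \<union> t) = n"
          by (rule Min_eqI) (use t smooth_tree.finite_node[OF U(1)] in auto)
        moreover have "{n} \<union> t - {n} = t" using t(2) by auto
        ultimately show ?thesis using n t(1) by (auto simp: T_def)
      qed
      then have "rk (U j) {} \<le> rk T ({n} \<union> {})"
        using smooth_tree.root[OF U(1)] by (intro smooth_tree.rk_prefix[OF U(1) wf]) auto
      moreover have "rk T (insert n {}) < rk T {}"
        by (rule rk_insert_less[OF wf])
          (use n smooth_tree.root[OF U(1)] in \<open>auto simp: T_def\<close>)
      ultimately show False using j U(2) by simp
    qed
    ultimately show ?thesis using T by (intro exI[of _ T]) simp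
  qed
qed


subsection \<open>Sums\<close>

text \<open>Follows the order of \<open>\<oplus>\<close>: \<open>B\<close> is traversed first, and
  \<open>A\<close> continues above each of its leaves. Ranks count from the leaves towards the root,
  hence \<open>A\<close> on the left in \<open>rk_tree_sum\<close>.\<close>

definition tree_sum :: "nat set set \<Rightarrow> nat set set \<Rightarrow> nat set set" where
  "tree_sum A B = B \<union> {x. \<exists>s\<in>leaves B. init_seg s x \<and> x - s \<in> A}"

lemma tree_sum_children:
  assumes "\<forall>y\<in>x. y < n" "init_seg s (insert n x)"
  shows "s = insert n x \<or> init_seg s x \<and> insert n x - s = insert n (x - s) \<and> (\<forall>y\<in>x - s. y < n)"
proof -
  have "s = insert n x \<or> init_seg s x"
    using assms by (metis pinit_seg_def pinit_seg_insert_iff)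
  moreover have "n \<notin> s" if "init_seg s x" using assms(1) that by (auto simp: init_seg_def)
  ultimately show ?thesis using assms(1) by auto
qed

context
  fixes Y A B
  assumes A: "smooth_tree Y A" and B: "smooth_tree Y B"
begin

interpretation A: smooth_tree Y A by (rule A)
interpretation B: smooth_tree Y B by (rule B)

lemma tree_sum_Un: "s \<in> leaves B \<Longrightarrow> t \<in> A \<Longrightarrow> \<forall>x\<in>s. \<forall>y\<in>t. x < y \<Longrightarrow> s \<union> t \<in> tree_sum A B"
proof -
  assume s: "s \<in> leaves B" and t: "t \<in> A" and lt: "\<forall>x\<in>s. \<forall>y\<in>t. x < y"
  then have "(s \<union> t) - s = t" by auto
  then show "s \<union> t \<in> tree_sum A B" using s t init_seg_Un[OF lt] by (auto simp: tree_sum_def)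
qed

lemma tree_sum_rk_aux:
  shows "wf (children (tree_sum A B))" and "rk (tree_sum A B) {} \<le> rk A {} + rk B {}"
proof -
  \<comment> \<open>Inside \<open>B\<close> the whole of \<open>A\<close> is still ahead; past a
    leaf \<open>s\<close> of \<open>B\<close> only what follows \<open>x - s\<close> in
    \<open>A\<close> is. At a leaf of \<open>B\<close> the two values agree.\<close>
  define v where "v x = (if x \<in> B then {rk A {} + rk B x} else {}) \<union>
    (\<lambda>s. rk A (x - s)) ` {s \<in> leaves B. init_seg s x \<and> x - s \<in> A}" for x
  have v: "finite (v x) \<and> v x \<noteq> {}" if x: "x \<in> tree_sum A B" for x
  proof -
    have "finite x"
    proof (cases "x \<in> B")
      case False
      then obtain s where "s \<in> B" "x - s \<in> A" using x by (auto simp: tree_sum_def leaves_def)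
      then have "finite s" "finite (x - s)" by (auto intro: A.finite_node B.finite_node)
      then show ?thesis by (metis finite_Diff2)
    qed (rule B.finite_node)
    then have "finite {s \<in> leaves B. init_seg s x \<and> x - s \<in> A}"
      by (auto intro!: finite_subset[OF _ finite_Pow_iff[THEN iffD2]] simp: init_seg_def)
    then show ?thesis using x by (auto simp: v_def tree_sum_def)
  qed
  have dec: "\<exists>y\<in>v x. z < y" if x: "\<forall>y\<in>x. y < n" "z \<in> v (insert n x)" for x n z
  proof -
    have inB: "x \<in> B" "rk B (insert n x) < rk B x" if "insert n x \<in> B"
      using B.parent[OF that x(1)] rk_insert_less[OF B.wf _ x(1) that] by blast+
    consider "insert n x \<in> B" "z = rk A {} + rk B (insert n x)"
      | s where "s \<in> leaves B" "init_seg s (insert n x)" "insert n x - s \<in> A" "z = rk A (insert n x - s)"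
      using x(2) by (auto simp: v_def split: if_splits)
    then show ?thesis
    proof cases
      case 1
      with inB show ?thesis by (auto simp: v_def oadd_strict_mono)
    next
      case (2 s)
      from tree_sum_children[OF x(1) 2(2)] show ?thesis
      proof
        assume s: "s = insert n x"
        then have "insert n x \<in> B" using 2(1) by (simp add: leaves_def)
        note inB = inB[OF this]
        have "rk A {} + 0 < rk A {} + rk B x"
          using inB(2) by (intro oadd_strict_mono) (rule le_less_trans[OF zero_le_cord])
        then show ?thesis using s 2(4) inB(1) by (auto simp: v_def)
      next
        assume s: "init_seg s x \<and> insert n x - s = insert n (x - s) \<and> (\<forall>y\<in>x - s. y < n)"
        with 2(3) have "insert n (x - s) \<in> A" by simp
        then have "x - s \<in> A" "rk A (insert n (x - s)) < rk A (x - s)"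
          using s A.parent rk_insert_less[OF A.wf] by blast+
        then show ?thesis using s 2(1,4) by (auto simp: v_def)
      qed
    qed
  qed
  show "wf (children (tree_sum A B))"
    by (rule rk_le_Max(1)[of _ v]) (use v dec in auto)
  have "{} \<in> tree_sum A B" using B.root by (simp add: tree_sum_def)
  then have "rk (tree_sum A B) {} \<le> Max (v {})" "finite (v {})" "v {} \<noteq> {}"
    using rk_le_Max(2)[of "tree_sum A B" v "{}"] v dec by auto
  moreover have "\<forall>z\<in>v {}. z \<le> rk A {} + rk B {}" by (auto simp: v_def le_oadd)
  ultimately show "rk (tree_sum A B) {} \<le> rk A {} + rk B {}" by (meson Max_in order_trans)
qed

text \<open>For \<open>extend\<close>, the larger set leaves \<open>B\<close> no earlier than the
  smaller one: its leaf \<open>l\<close> corresponds to an initial segment \<open>v\<close> of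
  \<open>x\<close> that contains the leaf \<open>s\<close>. The remainder of \<open>x\<close> past
  \<open>v\<close> is a subset of the one past \<open>s\<close>, so it stays in
  \<open>A\<close>.\<close>

lemma smooth_tree_sum: "smooth_tree Y (tree_sum A B)"
proof
  show "infinite Y" by (rule A.infinite_base)
  show "wf (children (tree_sum A B))" by (rule tree_sum_rk_aux(1))
  show "{} \<in> tree_sum A B" using B.root by (simp add: tree_sum_def)
  have "finite x \<and> x \<subseteq> Y" if x: "x \<in> tree_sum A B" for x
  proof (cases "x \<in> B")
    case False
    then obtain s where "s \<in> B" "x - s \<in> A" using x by (auto simp: tree_sum_def leaves_def)
    then have "finite s" "s \<subseteq> Y" "finite (x - s)" "x - s \<subseteq> Y"
      using A.finite_node B.finite_node A.node_subset B.node_subset by auto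
    then show ?thesis by (metis Diff_subset_conv Un_absorb1 finite_Diff2)
  qed (use B.finite_node B.node_subset in auto)
  then show "x \<in> tree_sum A B \<Longrightarrow> finite x" "x \<in> tree_sum A B \<Longrightarrow> x \<subseteq> Y" for x by auto
  show "x \<in> tree_sum A B" if x: "insert n x \<in> tree_sum A B" "\<forall>y\<in>x. y < n" for n x
  proof (cases "insert n x \<in> B")
    case True
    then show ?thesis using B.parent x(2) by (auto simp: tree_sum_def)
  next
    case False
    then obtain s where s: "s \<in> leaves B" "init_seg s (insert n x)" "insert n x - s \<in> A"
      using x(1) by (auto simp: tree_sum_def)
    moreover have "s \<noteq> insert n x" using False s(1) by (auto simp: leaves_def)
    ultimately show ?thesis using tree_sum_children[OF x(2) s(2)] A.parent by (auto simp: tree_sum_def)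
  qed
  show "insert m y \<in> tree_sum A B"
    if h: "insert n x \<in> tree_sum A B" "\<forall>z\<in>x. z < n" "x \<preceq> y" "\<forall>z\<in>y. z < m" "insert m y \<subseteq> Y" for n x m y
  proof (cases "insert n x \<in> B \<or> insert m y \<in> B")
    case True
    then show ?thesis using B.extend[OF _ h(2-5)] by (auto simp: tree_sum_def)
  next
    case False
    then obtain s where s: "s \<in> leaves B" "init_seg s (insert n x)" "insert n x - s \<in> A"
      using h(1) by (auto simp: tree_sum_def)
    moreover have "s \<noteq> insert n x" using False s(1) by (auto simp: leaves_def)
    ultimately have sx: "init_seg s x" "insert n (x - s) \<in> A" "\<forall>z\<in>x - s. z < n"
      using tree_sum_children[OF h(2) s(2)] by auto
    have "finite s" "finite (x - s)"
      using s(1) A.parent[OF sx(2,3)] A.finite_node B.finite_node by (auto simp: leaves_def)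
    then have fx: "finite x" by (metis finite_Diff2)
    then have "finite (insert m y)" using h(3) pointwise_le_finite by simp
    then obtain l where l: "l \<in> leaves B" "pinit_seg l (insert m y)"
      using B.in_tree_or_leaf_below[of "insert m y"] h(5) False by blast
    then have ly: "init_seg l y" using pinit_seg_insert_iff[OF h(4)] by blast
    obtain v where v: "init_seg v x" "v \<preceq> l" "x - v \<preceq> y - l"
      using fx h(3) ly by (rule pointwise_le_split)
    have "\<not> pinit_seg v s"
      using B.leaf_no_larger_node[OF l(1) _ _ _ v(2), of s] s(1) by (auto simp: pinit_seg_def leaves_def)
    then have "init_seg s v" using init_seg_comparable[OF sx(1) v(1)] by blast
    then have "insert n (x - v) \<subseteq> insert n (x - s)" by (auto simp: init_seg_def)
    then have "insert n (x - v) \<in> A" using sx(2) by (rule A.subset_node[rotated])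
    moreover have "\<forall>z\<in>x - v. z < n" "\<forall>z\<in>y - l. z < m" "insert m (y - l) \<subseteq> Y" using h by auto
    ultimately have "insert m (y - l) \<in> A" using v(3) A.extend by blast
    moreover have "insert m y - l = insert m (y - l)" using ly h(4) by (auto simp: init_seg_def)
    ultimately show ?thesis using l by (auto simp: tree_sum_def pinit_seg_def)
  qed
qed

lemma rk_tree_sum: "rk (tree_sum A B) {} = rk A {} + rk B {}"
proof -
  note wf = tree_sum_rk_aux(1)
  have sub: "B \<subseteq> tree_sum A B" by (auto simp: tree_sum_def)
  have "rk A {} + rk B s \<le> rk (tree_sum A B) s" if "s \<in> B" for s
    using B.wf that
  proof (induction s rule: wf_induct_rule)
    case (less s)
    have child: "rk A {} + rk B (insert n s) < rk (tree_sum A B) s"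
      if "\<forall>x\<in>s. x < n" "insert n s \<in> B" for n
    proof -
      have "rk A {} + rk B (insert n s) \<le> rk (tree_sum A B) (insert n s)"
        using that less.prems by (intro less.IH) (auto simp: children_def)
      also have "\<dots> < rk (tree_sum A B) s"
        using that less.prems sub by (intro rk_insert_less[OF wf]) auto
      finally show ?thesis .
    qed
    show ?case
    proof (cases "s \<in> leaves B")
      case True
      have "rk A {} \<le> rk (tree_sum A B) (s \<union> {})"
        using B.finite_node[OF less.prems] tree_sum_Un[OF True] A.root
        by (intro A.rk_prefix[OF wf]) auto
      then show ?thesis using True by (simp add: B.rk_leaf)
    next
      case False
      show ?thesis
      proof (rule leI, rule notI)
        assume "rk (tree_sum A B) s < rk A {} + rk B s"
        then consider "rk (tree_sum A B) s < rk A {}" | e where "e < rk B s" "rk (tree_sum A B) s \<le> rk A {} + e"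
          unfolding less_oadd_iff by blast
        then show False
        proof cases
          case 1
          obtain n where "\<forall>x\<in>s. x < n" "insert n s \<in> B" using False less.prems by (auto simp: leaves_def)
          then have "rk A {} + rk B (insert n s) < rk (tree_sum A B) s" by (rule child)
          then have "rk A {} < rk (tree_sum A B) s" using le_oadd by (rule le_less_trans[rotated])
          with 1 show False by simp
        next
          case 2
          then obtain n where n: "\<forall>x\<in>s. x < n" "insert n s \<in> B" "e \<le> rk B (insert n s)"
            unfolding less_rk_iff[OF B.wf] by blast
          then have "rk A {} + e \<le> rk A {} + rk B (insert n s)" by (intro oadd_mono)
          also have "\<dots> < rk (tree_sum A B) s" using n(1,2) by (rule child)
          finally show False using 2(2) by simp
        qed
      qed
    qed
  qed
  then show ?thesis using tree_sum_rk_aux(2) B.root by (simp add: antisym)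
qed

lemma leaves_tree_sum: "leaves (tree_sum A B) = leaves A \<oplus> leaves B"
proof (intro set_eqI iffI)
  fix x assume x: "x \<in> leaves (tree_sum A B)"
  then have xs: "x \<in> tree_sum A B" by (simp add: leaves_def)
  have "\<exists>s\<in>leaves B. init_seg s x \<and> x - s \<in> A"
  proof (cases "x \<in> B")
    case True
    then have "x \<in> leaves B" using x by (auto simp: leaves_def tree_sum_def)
    then show ?thesis using A.root by (intro bexI[of _ x]) auto
  qed (use xs in \<open>auto simp: tree_sum_def\<close>)
  then obtain s where s: "s \<in> leaves B" "init_seg s x" "x - s \<in> A" by blast
  have "x - s \<in> leaves A"
  proof (rule ccontr)
    assume "x - s \<notin> leaves A"
    then obtain n where n: "\<forall>y\<in>x - s. y < n" "insert n (x - s) \<in> A" using s(3) by (auto simp: leaves_def)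
    have "finite x" using smooth_tree.finite_node[OF smooth_tree_sum xs] .
    \<comment> \<open>\<open>n\<close> is only known to exceed \<open>x - s\<close>, which may be
      empty; \<open>extend\<close> replaces it by a point beyond all of \<open>x\<close>.\<close>
    then obtain m where m: "m \<in> Y" "\<forall>y\<in>x. y < m" by (rule infinite_nat_above[OF A.infinite_base])
    have "insert m (x - s) \<in> A"
      using A.extend[OF n(2,1) pointwise_le_refl] m A.node_subset[OF s(3)] by simp
    moreover have "insert m x - s = insert m (x - s)" using s(2) m(2) by (auto simp: init_seg_def)
    moreover have "init_seg s (insert m x)" using init_seg_trans[OF s(2) init_seg_insert[OF m(2)]] .
    ultimately have "insert m x \<in> tree_sum A B" using s(1) by (auto simp: tree_sum_def)
    then show False using x m(2) by (auto simp: leaves_def)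
  qed
  moreover have "x = s \<union> (x - s)" "\<forall>y\<in>s. \<forall>z\<in>x - s. y < z" using s(2) by (auto simp: init_seg_def)
  ultimately show "x \<in> leaves A \<oplus> leaves B" using s(1) unfolding front_sum_def by blast
next
  fix x assume "x \<in> leaves A \<oplus> leaves B"
  then obtain s t where x: "x = s \<union> t" "s \<in> leaves B" "t \<in> leaves A" "\<forall>y\<in>s. \<forall>z\<in>t. y < z"
    by (auto simp: front_sum_def)
  have sx: "init_seg s x" using x(4) by (simp add: x(1) init_seg_Un)
  have "x \<in> tree_sum A B" using tree_sum_Un x by (simp add: leaves_def)
  moreover have "insert n x \<notin> tree_sum A B" if n: "\<forall>y\<in>x. y < n" for n
  proof
    assume n': "insert n x \<in> tree_sum A B"
    have "init_seg s (insert n x)" using init_seg_trans[OF sx init_seg_insert[OF n]] .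
    have p: "pinit_seg s (insert n x)" using pinit_seg_insert_iff[OF n] sx by blast
    then have "insert n x \<notin> B" using B.leaf_no_pinit_seg x(2) by blast
    then obtain s' where s': "s' \<in> leaves B" "init_seg s' (insert n x)" "insert n x - s' \<in> A"
      using n' by (auto simp: tree_sum_def)
    then have "s' = s" using B.leaf_unique[of s' s "insert n x"] x(2) \<open>init_seg s (insert n x)\<close> by blast
    moreover have "insert n x - s = insert n t" using n x(1,4) by auto
    ultimately show False using s'(3) x(1,3) n by (auto simp: leaves_def)
  qed
  ultimately show "x \<in> leaves (tree_sum A B)" by (auto simp: leaves_def)
qed

end

abbreviation blocks :: "nat set \<Rightarrow> nat set set list \<Rightarrow> cord list \<Rightarrow> bool" where
  "blocks Y \<equiv> list_all2 (\<lambda>T b. smooth_tree Y T \<and> rk T {} = omega_pow b)"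

lemma tree_sum_blocks:
  assumes "infinite Y" "blocks Y Ts bs"
  shows "smooth_tree Y (foldr tree_sum Ts {{}})"
    and "rk (foldr tree_sum Ts {{}}) {} = cnf_value bs"
    and "leaves (foldr tree_sum Ts {{}}) = foldr (\<oplus>) (map leaves Ts) {{}}"
proof -
  have "smooth_tree Y (foldr tree_sum Ts {{}}) \<and> rk (foldr tree_sum Ts {{}}) {} = cnf_value bs \<and>
      leaves (foldr tree_sum Ts {{}}) = foldr (\<oplus>) (map leaves Ts) {{}}"
    using assms(2)
    by (induction rule: list_all2_induct)
      (auto simp: smooth_tree_trivial[OF assms(1)] smooth_tree_sum rk_tree_sum leaves_tree_sum)
  then show "smooth_tree Y (foldr tree_sum Ts {{}})"
    "rk (foldr tree_sum Ts {{}}) {} = cnf_value bs"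
    "leaves (foldr tree_sum Ts {{}}) = foldr (\<oplus>) (map leaves Ts) {{}}" by auto
qed

section \<open>Decomposable majorants\<close>

text \<open>The tree is cut at the first nodes of rank at most \<open>\<omega>\<^bsup>b\<^esup>\<close>.  What remains above the cut depends
  on the node where it is reached, but only finitely many of these nodes lie below a given number,
  so a single tree of the same rank dominates all the remainders.\<close>

lemma majorize_cut:
  assumes D: "smooth_tree Y D" and rk: "rk D {} \<le> a + b"
  defines "E \<equiv> {s \<in> D. \<forall>u. pinit_seg u s \<longrightarrow> a < rk D u}"
  shows "smooth_tree Y E" and "rk E {} \<le> b"
proof -
  interpret D: smooth_tree Y D by (rule D)
  \<comment> \<open>The excess of the rank over \<open>a\<close>, truncated at 0. A node with a
    child in \<open>E\<close> has rank above \<open>a\<close>, so the excess drops along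
    \<open>E\<close>.\<close>
  define r where "r s = (LEAST x. rk D s \<le> a + x)" for s
  have "rk D s \<le> a + rk D s" for s using oadd_mono_left[of 0 a "rk D s"] by simp
  then have r: "rk D s \<le> a + r s" for s unfolding r_def by (rule LeastI)
  have r_le: "r s \<le> x" if "rk D s \<le> a + x" for s x using that unfolding r_def by (rule Least_le)
  have dec: "r (insert n s) < r s" if s: "s \<in> E" "\<forall>y\<in>s. y < n" "insert n s \<in> E" for s n
  proof -
    have D: "s \<in> D" "insert n s \<in> D" "a < rk D s"
      using s pinit_seg_insert[OF s(2)] by (auto simp: E_def)
    have "rk D (insert n s) < a + r s"
      using rk_insert_less[OF D.wf D(1) s(2) D(2)] r by (rule less_le_trans)
    then consider "rk D (insert n s) < a" | e where "e < r s" "rk D (insert n s) \<le> a + e"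
      unfolding less_oadd_iff by blast
    then show ?thesis
    proof cases
      case 1
      then have "r (insert n s) \<le> 0" by (intro r_le) simp
      moreover have "r s \<noteq> 0" using r[of s] D(3) by auto
      ultimately show ?thesis by (metis le_less_trans le_less zero_le_cord)
    next
      case 2
      then show ?thesis using r_le le_less_trans by blast
    qed
  qed
  note bound = rk_le_Max[of E "\<lambda>s. {r s}"]
  show E: "smooth_tree Y E"
  proof
    show "s \<in> E" if s: "insert n s \<in> E" "\<forall>x\<in>s. x < n" for n s
    proof -
      have "a < rk D u" if "pinit_seg u s" for u
        using s that pinit_seg_insert_iff[OF s(2)] by (auto simp: E_def pinit_seg_def)
      then show ?thesis using s D.parent by (auto simp: E_def)
    qed
    show "insert m t \<in> E"
      if h: "insert n s \<in> E" "\<forall>x\<in>s. x < n" "s \<preceq> t" "\<forall>x\<in>t. x < m" "insert m t \<subseteq> Y" for n s m t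
    proof -
      have D: "insert n s \<in> D" using h(1) by (simp add: E_def)
      then have mt: "insert m t \<in> D" using h(2-5) by (rule D.extend)
      moreover have "a < rk D u" if "pinit_seg u (insert m t)" for u
      proof -
        have u: "init_seg u t" using that pinit_seg_insert_iff[OF h(4)] by blast
        have s: "s \<in> D" using D h(2) by (rule D.parent)
        obtain v where v: "init_seg v s" "v \<preceq> u"
          using D.finite_node[OF s] h(3) u by (rule pointwise_le_split)
        have "pinit_seg v (insert n s)" using v(1) pinit_seg_insert_iff[OF h(2)] by blast
        then have "a < rk D v" using h(1) by (auto simp: E_def)
        also have "\<dots> \<le> rk D u"
          using D.initial[OF s v(1)] v(2) u h(5) by (intro D.rk_pointwise_mono) (auto simp: init_seg_def)
        finally show ?thesis .
      qed
      ultimately show ?thesis by (simp add: E_def)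
    qed
    show "wf (children E)" using D.wf by (rule wf_children_mono) (auto simp: E_def)
    show "{} \<in> E" using D.root by (auto simp: E_def pinit_seg_def init_seg_def)
    show "s \<in> E \<Longrightarrow> finite s" "s \<in> E \<Longrightarrow> s \<subseteq> Y" for s
      using D.finite_node D.node_subset by (auto simp: E_def)
  qed (rule D.infinite_base)
  have "rk E {} \<le> Max {r {}}"
    by (rule bound(2)) (use dec smooth_tree.root[OF E] in auto)
  also have "\<dots> \<le> b" using r_le[OF rk] by simp
  finally show "rk E {} \<le> b" .
qed

text \<open>All singletons are put in because \<open>extend\<close> forces a root with one child to
  have all possible ones. A singleton that starts no remainder has rank 0, which
  \<open>0 < a\<close> accommodates.\<close>

lemma majorize_remainders:
  assumes D: "smooth_tree Y D" and a: "0 < a"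
  defines "F \<equiv> insert {} ((\<lambda>n. {n}) ` Y) \<union>
    {t. \<exists>s\<in>D. rk D s \<le> a \<and> (\<forall>x\<in>s. \<forall>y\<in>t. x < y) \<and> s \<union> t \<in> D}"
  shows "smooth_tree Y F" and "rk F {} \<le> a"
proof -
  interpret D: smooth_tree Y D by (rule D)
  define S where "S t = {s \<in> D. rk D s \<le> a \<and> (\<forall>x\<in>s. \<forall>y\<in>t. x < y) \<and> s \<union> t \<in> D}" for t
  \<comment> \<open>At the root \<open>S {}\<close> may be infinite, so the value \<open>a\<close>
    is assigned outright; elsewhere any point of \<open>t\<close> bounds the cut nodes in
    \<open>S t\<close>. The 0 provides for singletons that start no remainder.\<close>
  define v where "v t = (if t = {} then {a} else insert 0 ((\<lambda>s. rk D (s \<union> t)) ` S t))" for t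
  have F: "t \<in> F \<longleftrightarrow> t = {} \<or> (\<exists>n\<in>Y. t = {n}) \<or> S t \<noteq> {}" for t
    by (auto simp: F_def S_def)
  have S: "s \<in> S t \<and> rk D (s \<union> insert n t) < rk D (s \<union> t)"
    if s: "s \<in> S (insert n t)" and t: "\<forall>y\<in>t. y < n" for s t n
  proof -
    have "\<forall>x\<in>s \<union> t. x < n" "insert n (s \<union> t) \<in> D" using s t by (auto simp: S_def)
    then have "s \<union> t \<in> D" "rk D (insert n (s \<union> t)) < rk D (s \<union> t)"
      using D.parent rk_insert_less[OF D.wf] by blast+
    then show ?thesis using s by (auto simp: S_def)
  qed
  have nonempty: "S (insert n t) \<noteq> {}" if "insert n t \<in> F" "t \<noteq> {}" "\<forall>y\<in>t. y < n" for n t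
    using that by (auto simp: F)
  have v: "finite (v t) \<and> v t \<noteq> {}" for t
  proof (cases "t = {}")
    case False
    then obtain y where "y \<in> t" by blast
    then have "S t \<subseteq> Pow {..<y}" by (auto simp: S_def)
    then have "finite (S t)" by (rule finite_subset) simp
    then show ?thesis by (simp add: v_def)
  qed (simp add: v_def)
  have dec: "\<exists>y\<in>v t. x < y" if t: "\<forall>y\<in>t. y < n" "insert n t \<in> F" "x \<in> v (insert n t)" for t n x
  proof (cases "t = {}")
    case True
    have "rk D (s \<union> {n}) < a" if "s \<in> S {n}" for s
      using S[of s n "{}"] that by (auto simp: S_def intro: less_le_trans)
    then show ?thesis using True t(3) a by (auto simp: v_def)
  next
    case False
    have "\<exists>s\<in>S (insert n t). x \<le> rk D (s \<union> insert n t)"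
      using t(3) nonempty[OF t(2) False t(1)] by (auto simp: v_def)
    then obtain s where s: "s \<in> S (insert n t)" "x \<le> rk D (s \<union> insert n t)" by blast
    then have "s \<in> S t" "x < rk D (s \<union> t)" using S[OF s(1) t(1)] by auto
    then show ?thesis using False by (auto simp: v_def)
  qed
  note bound = rk_le_Max[of F v]
  show "smooth_tree Y F"
  proof
    show "wf (children F)" by (rule bound(1)) (use v dec in auto)
    show "t \<in> F" if t: "insert n t \<in> F" "\<forall>x\<in>t. x < n" for n t
    proof (cases "t = {}")
      case False
      then obtain s where "s \<in> S (insert n t)" using nonempty t by blast
      then have "s \<in> S t" using S t(2) by blast
      then show ?thesis by (auto simp: F)
    qed (simp add: F)
    show "insert m t' \<in> F"
      if h: "insert n t \<in> F" "\<forall>x\<in>t. x < n" "t \<preceq> t'" "\<forall>x\<in>t'. x < m" "insert m t' \<subseteq> Y" for n t m t'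
    proof (cases "t = {}")
      case True
      then show ?thesis using h by (auto simp: F)
    next
      case False
      then obtain s where s: "s \<in> S (insert n t)" using nonempty h by blast
      then have st: "\<forall>x\<in>s. \<forall>y\<in>t. x < y" "insert n (s \<union> t) \<in> D" "\<forall>x\<in>s \<union> t. x < n" and D: "s \<in> D"
        using h(2) by (auto simp: S_def)
      have t': "t' \<noteq> {}" "\<forall>x\<in>s. \<forall>y\<in>t'. x < y"
        using False h(3) pointwise_le_above[OF h(3)] st(1) by auto
      then have "\<forall>x\<in>s. x < m" using h(4) by (meson all_not_in_conv less_trans)
      then have m: "\<forall>x\<in>s \<union> t'. x < m" using h(4) by auto
      have "insert m (s \<union> t') \<in> D"
        by (rule D.extend[OF st(2,3) pointwise_le_Un[OF h(3) st(1)] m])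
          (use h(5) D.node_subset[OF D] in auto)
      then have "s \<in> S (insert m t')" using s t' m by (auto simp: S_def)
      then show ?thesis by (auto simp: F)
    qed
    have "finite t \<and> t \<subseteq> Y" if St: "S t \<noteq> {}" for t
    proof -
      obtain s where "s \<union> t \<in> D" using St by (auto simp: S_def)
      then show ?thesis using D.finite_node[of "s \<union> t"] D.node_subset[of "s \<union> t"] by simp
    qed
    then show "t \<in> F \<Longrightarrow> finite t" "t \<in> F \<Longrightarrow> t \<subseteq> Y" for t by (auto simp: F)
  qed (simp_all add: F D.infinite_base)
  have "rk F {} \<le> Max (v {})"
    by (rule bound(2)) (use v dec in \<open>auto simp: F\<close>)
  then show "rk F {} \<le> a" by (simp add: v_def)
qed

text \<open>The induction splits off the leading exponent \<open>b\<close>: \<open>E\<close> is the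
  part of \<open>D\<close> up to the first nodes of rank at most \<open>omega_pow b\<close>, and
  \<open>F\<close> collects what may follow them. The union with \<open>C\<close> brings the rank of
  the last part up to exactly \<open>omega_pow b\<close>, as decomposability demands.\<close>

lemma majorize_blocks:
  assumes "smooth_tree Y D" "rk D {} \<le> cnf_value bs"
  shows "\<exists>Ts. blocks Y Ts bs \<and> D \<subseteq> foldr tree_sum Ts {{}}"
  using assms
proof (induction bs arbitrary: D)
  case Nil
  then have "D = {{}}" by (intro smooth_tree.trivial_if_rk_root) (simp_all add: antisym)
  then show ?case by (intro exI[of _ "[]"]) simp
next
  case (Cons b bs)
  interpret D: smooth_tree Y D by (rule Cons.prems(1))
  define E where "E = {s \<in> D. \<forall>u. pinit_seg u s \<longrightarrow> omega_pow b < rk D u}"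
  define F where "F = insert {} ((\<lambda>n. {n}) ` Y) \<union>
    {t. \<exists>s\<in>D. rk D s \<le> omega_pow b \<and> (\<forall>x\<in>s. \<forall>y\<in>t. x < y) \<and> s \<union> t \<in> D}"
  have "rk D {} \<le> omega_pow b + cnf_value bs" using Cons.prems(2) by simp
  then have "smooth_tree Y E" "rk E {} \<le> cnf_value bs"
    unfolding E_def by (rule majorize_cut[OF D.smooth_tree_axioms])+
  then obtain Ts where Ts: "blocks Y Ts bs" "E \<subseteq> foldr tree_sum Ts {{}}" using Cons.IH by blast
  have F: "smooth_tree Y F" "rk F {} \<le> omega_pow b"
    unfolding F_def by (rule majorize_remainders[OF D.smooth_tree_axioms omega_pow_pos])+
  obtain C where C: "smooth_tree Y C" "rk C {} = omega_pow b"
    using smooth_tree_of_rk[OF D.infinite_base] by blast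
  have FC: "smooth_tree Y (F \<union> C)" "rk (F \<union> C) {} = omega_pow b"
    using smooth_tree_Un[OF F(1) C(1)] F(2) C(2) by auto
  interpret E': smooth_tree Y "foldr tree_sum Ts {{}}"
    by (rule tree_sum_blocks(1)[OF D.infinite_base Ts(1)])
  have "x \<in> tree_sum (F \<union> C) (foldr tree_sum Ts {{}})" if x: "x \<in> D" for x
  proof (cases "x \<in> foldr tree_sum Ts {{}}")
    case True
    then show ?thesis by (simp add: tree_sum_def)
  next
    case False
    then obtain l where l: "l \<in> leaves (foldr tree_sum Ts {{}})" "pinit_seg l x"
      using E'.in_tree_or_leaf_below[OF D.finite_node[OF x] D.node_subset[OF x]] by blast
    obtain n where n: "\<forall>y\<in>l. y < n" "init_seg (insert n l) x" using l(2) by (rule pinit_seg_next)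
    \<comment> \<open>Above a leaf of the majorant of \<open>E\<close> the next point leaves
      \<open>E\<close>, so the rank in \<open>D\<close> has fallen to \<open>omega_pow b\<close> or
      less at \<open>l\<close> or before.\<close>
    have "insert n l \<notin> E" using Ts(2) l(1) n(1) by (auto simp: leaves_def)
    moreover have "insert n l \<in> D" using x n(2) by (rule D.initial)
    ultimately obtain u where u: "pinit_seg u (insert n l)" "rk D u \<le> omega_pow b"
      by (auto simp: E_def not_less)
    have lx: "init_seg l x" using l(2) by (simp add: pinit_seg_def)
    have lD: "l \<in> D" using x lx by (rule D.initial)
    have "init_seg u l" using u(1) pinit_seg_insert_iff[OF n(1)] by blast
    then have "rk D l \<le> rk D u" by (rule D.rk_descendant[OF lD])
    then have "rk D l \<le> omega_pow b" using u(2) by simp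
    moreover have "l \<union> (x - l) = x" using lx by (auto simp: init_seg_def)
    ultimately have "x - l \<in> F" using lD x init_segD[OF lx] unfolding F_def by auto
    then show ?thesis using l(1) lx by (auto simp: tree_sum_def)
  qed
  then show ?case using Ts(1) FC by (intro exI[of _ "(F \<union> C) # Ts"]) auto
qed

text \<open>All blocks share the base \<open>Y\<close>, so the condition on final segments is
  immediate. Height 0 forces the degenerate front and therefore the base
  \<open>UNIV\<close>.\<close>

lemma sd_barrier_majorant:
  assumes "smooth_tree Y D" "rk D {} \<le> a" "a = 0 \<Longrightarrow> Y = UNIV"
  obtains B where "sd_barrier B" "ht B = a" "base B = Y" "D \<subseteq> front_tree B"
proof -
  have Y: "infinite Y" using assms(1) by (rule smooth_tree.infinite_base)
  obtain bs where bs: "sorted_wrt (\<ge>) bs" "a = cnf_value bs"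
    using cnf_exists[of a] unfolding is_cnf_def by blast
  obtain Ts where Ts: "blocks Y Ts bs" "D \<subseteq> foldr tree_sum Ts {{}}"
    using majorize_blocks[of Y D bs] assms(1,2) bs(2) by blast
  define T where "T = foldr tree_sum Ts {{}}"
  have T: "smooth_tree Y T" "rk T {} = a" "leaves T = foldr (\<oplus>) (map leaves Ts) {{}}"
    unfolding T_def bs(2) by (fact tree_sum_blocks[OF Y Ts(1)])+
  interpret smooth_tree Y T by (rule T(1))
  have triv: "Y = UNIV" if "T = {{}}" using T(2) assms(3) that by simp
  have len: "length Ts = length bs" using Ts(1) by (rule list_all2_lengthD)
  have block: "smooth_barrier (leaves (Ts ! i))" "ht (leaves (Ts ! i)) = omega_pow (bs ! i)"
      "base (leaves (Ts ! i)) = Y" if "i < length bs" for i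
  proof -
    note i = list_all2_nthD2[OF Ts(1) that]
    interpret Ti: smooth_tree Y "Ts ! i" using i by (rule conjunct1)
    have rk: "rk (Ts ! i) {} = omega_pow (bs ! i)" using i by (rule conjunct2)
    have "Ts ! i \<noteq> {{}}"
    proof
      assume "Ts ! i = {{}}"
      then have "omega_pow (bs ! i) = 0" using rk by simp
      then show False using omega_pow_pos[of "bs ! i"] by simp
    qed
    then have triv: "Ts ! i = {{}} \<Longrightarrow> Y = UNIV" by contradiction
    show "smooth_barrier (leaves (Ts ! i))" using triv by (rule Ti.smooth_barrier_leaves)
    show "ht (leaves (Ts ! i)) = omega_pow (bs ! i)" using Ti.ht_leaves[OF triv] rk by (rule trans)
    show "base (leaves (Ts ! i)) = Y" using triv by (rule Ti.base_leaves)
  qed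
  have ht: "ht (leaves T) = a" using ht_leaves[OF triv] T(2) by simp
  have "final_segment Y Y" unfolding final_segment_def by (intro exI[of _ 0]) simp
  then have "decomposable (leaves T)"
    unfolding decomposable_def ht is_cnf_def
    using bs T(3) block len by (intro exI[of _ bs] exI[of _ "map leaves Ts"]) simp
  then have "sd_barrier (leaves T)" using smooth_barrier_leaves[OF triv] by (simp add: sd_barrier_def)
  moreover have "D \<subseteq> front_tree (leaves T)" using Ts(2) front_tree_leaves[OF triv] by (simp add: T_def)
  ultimately show thesis using that ht base_leaves[OF triv] by blast
qed

lemma sd_barrier_exists:
  obtains B where "sd_barrier B" "ht B = a" "base B = UNIV"
  using sd_barrier_majorant[OF smooth_tree_trivial[of UNIV], of a] by auto


section \<open>Merging trees\<close>

text \<open>For \<open>k = 0\<close> only the empty set remains, matching the empty natural sum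
  0.\<close>

definition tree_merge :: "nat set \<Rightarrow> nat \<Rightarrow> (nat \<Rightarrow> nat set set) \<Rightarrow> nat set set" where
  "tree_merge Y k T = {s. finite s \<and> s \<subseteq> Y \<and>
     (\<exists>c. c ` s \<subseteq> {..<k} \<and> (\<forall>i<k. {x \<in> s. c x = i} \<in> T i))}"

context
  fixes Y :: "nat set" and k :: nat and T :: "nat \<Rightarrow> nat set set"
  assumes Y: "infinite Y" and T: "\<And>i. i < k \<Longrightarrow> smooth_tree Y (T i)"
begin

definition colour_rk :: "(nat \<Rightarrow> nat) \<Rightarrow> nat set \<Rightarrow> cord" where
  "colour_rk c s = hsum_list (map (\<lambda>i. rk (T i) {x \<in> s. c x = i}) [0..<k])"

lemma colour_class_insert:
  "\<forall>x\<in>s. x < n \<Longrightarrow> {x \<in> insert n s. c x = i} =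
    (if c n = i then insert n {x \<in> s. c x = i} else {x \<in> s. c x = i})"
  by auto

lemma colour_rk_insert_less:
  assumes "\<forall>x\<in>s. x < n" "c ` insert n s \<subseteq> {..<k}" "\<forall>i<k. {x \<in> insert n s. c x = i} \<in> T i"
  shows "\<forall>i<k. {x \<in> s. c x = i} \<in> T i" and "colour_rk c (insert n s) < colour_rk c s"
proof -
  have below: "\<forall>x\<in>{x \<in> s. c x = i}. x < n" for i using assms(1) by simp
  show cls: "\<forall>i<k. {x \<in> s. c x = i} \<in> T i"
  proof (intro allI impI)
    fix i assume i: "i < k"
    then show "{x \<in> s. c x = i} \<in> T i"
      using assms(3) smooth_tree.parent[OF T[OF i] _ below[of i]] colour_class_insert[OF assms(1), of c i]
      by (auto split: if_splits)
  qed
  let ?r = "\<lambda>i. rk (T i) {x \<in> s. c x = i}"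
  have n: "c n < k" using assms(2) by auto
  then have "insert n {x \<in> s. c x = c n} \<in> T (c n)"
    using assms(3) colour_class_insert[OF assms(1), of c "c n"] by auto
  then have less: "rk (T (c n)) (insert n {x \<in> s. c x = c n}) < ?r (c n)"
    using rk_insert_less[OF smooth_tree.wf[OF T[OF n]]] cls n below by blast
  have "rk (T i) {x \<in> insert n s. c x = i} = (?r(c n := rk (T (c n)) (insert n {x \<in> s. c x = c n}))) i"
    for i unfolding colour_class_insert[OF assms(1)] by auto
  then have "colour_rk c (insert n s) =
      hsum_list (map (?r(c n := rk (T (c n)) (insert n {x \<in> s. c x = c n}))) [0..<k])"
    unfolding colour_rk_def by presburger
  also have "\<dots> < hsum_list (map ?r [0..<k])" using n less by (rule hsum_list_strict_mono)
  finally show "colour_rk c (insert n s) < colour_rk c s" by (simp add: colour_rk_def)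
qed

lemma tree_merge_rk_le:
  shows "wf (children (tree_merge Y k T))"
    and "rk (tree_merge Y k T) {} \<le> hsum_list (map (\<lambda>i. rk (T i) {}) [0..<k])"
proof -
  define good where "good s = {c. c ` s \<subseteq> {..<k} \<and> (\<forall>i<k. {x \<in> s. c x = i} \<in> T i)}" for s :: "nat set"
  define v where "v s = (\<lambda>c. colour_rk c s) ` good s" for s
  have fin: "finite (v s) \<and> v s \<noteq> {}" if "s \<in> tree_merge Y k T" for s
  proof -
    \<comment> \<open>There are infinitely many colourings \<open>c\<close>, but
      \<open>colour_rk c s\<close> depends only on ranks of subsets of the finite set
      \<open>s\<close>, so it takes finitely many values.\<close>
    define V where "V = (\<Union>i<k. rk (T i) ` Pow s)"
    have V: "finite V" using that by (simp add: V_def tree_merge_def)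
    have "rk (T i) {x \<in> s. c x = i} \<in> V" if "i < k" for i c
      using that by (auto simp: V_def)
    then have "v s \<subseteq> hsum_list ` {xs. set xs \<subseteq> V \<and> length xs = k}"
      by (auto simp: v_def colour_rk_def intro!: imageI)
    then have "finite (v s)"
      by (rule finite_subset[OF _ finite_imageI[OF finite_lists_length_eq[OF V]]])
    then show ?thesis using that by (auto simp: v_def good_def tree_merge_def)
  qed
  have dec: "\<exists>y\<in>v s. x < y" if s: "\<forall>y\<in>s. y < n" "x \<in> v (insert n s)" for s n x
  proof -
    obtain c where c: "c \<in> good (insert n s)" "x = colour_rk c (insert n s)" using s(2) by (auto simp: v_def)
    then have "c \<in> good s" "x < colour_rk c s"
      using colour_rk_insert_less[OF s(1), of c] by (auto simp: good_def)
    then show ?thesis by (auto simp: v_def)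
  qed
  show "wf (children (tree_merge Y k T))" by (rule rk_le_Max(1)[OF fin dec])
  have root: "{} \<in> T i" if "i < k" for i using T[OF that] by (rule smooth_tree.root)
  then have "v {} = {hsum_list (map (\<lambda>i. rk (T i) {}) [0..<k])}"
    by (auto simp: v_def good_def colour_rk_def)
  moreover have "rk (tree_merge Y k T) {} \<le> Max (v {})"
    by (rule rk_le_Max(2)[OF fin dec]) (use root in \<open>simp_all add: tree_merge_def\<close>)
  ultimately show "rk (tree_merge Y k T) {} \<le> hsum_list (map (\<lambda>i. rk (T i) {}) [0..<k])"
    by simp
qed

lemma smooth_tree_merge: "smooth_tree Y (tree_merge Y k T)"
proof
  show "infinite Y" by (rule Y)
  show "wf (children (tree_merge Y k T))" by (rule tree_merge_rk_le(1))
  show "{} \<in> tree_merge Y k T" using smooth_tree.root[OF T] by (auto simp: tree_merge_def)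
  show "s \<in> tree_merge Y k T" if s: "insert n s \<in> tree_merge Y k T" "\<forall>x\<in>s. x < n" for n s
  proof -
    obtain c where c: "c ` insert n s \<subseteq> {..<k}" "\<forall>i<k. {x \<in> insert n s. c x = i} \<in> T i"
      and fin: "finite (insert n s)" "insert n s \<subseteq> Y" using s(1) unfolding tree_merge_def by blast
    have "\<forall>i<k. {x \<in> s. c x = i} \<in> T i" using s(2) c by (rule colour_rk_insert_less(1))
    then show ?thesis using c(1) fin unfolding tree_merge_def by auto
  qed
  show "insert m t \<in> tree_merge Y k T"
    if h: "insert n s \<in> tree_merge Y k T" "\<forall>x\<in>s. x < n" "s \<preceq> t" "\<forall>x\<in>t. x < m" "insert m t \<subseteq> Y" for n s m t
  proof -
    obtain c where c: "c ` insert n s \<subseteq> {..<k}" "\<forall>i<k. {x \<in> insert n s. c x = i} \<in> T i"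
      and fin: "finite (insert n s)" using h(1) unfolding tree_merge_def by blast
    have cls: "\<forall>i<k. {x \<in> s. c x = i} \<in> T i" using h(2) c by (rule colour_rk_insert_less(1))
    obtain c' where c': "c' ` t \<subseteq> c ` s" "\<And>i. {x \<in> s. c x = i} \<preceq> {x \<in> t. c' x = i}"
      using pointwise_le_colouring[OF h(3), of c] by blast
    \<comment> \<open>The new last point inherits the colour of \<open>n\<close>; all other colours
      are transported along \<open>s \<preceq> t\<close>.\<close>
    let ?d = "c'(m := c n)"
    have m: "m \<notin> t" using h(4) by blast
    have d: "{x \<in> t. ?d x = i} = {x \<in> t. c' x = i}" for i using m by auto
    have "{x \<in> insert m t. ?d x = i} \<in> T i" if i: "i < k" for i
    proof (cases "c n = i")
      case True
      have "insert n {x \<in> s. c x = i} \<in> T i"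
        using c(2) i True colour_class_insert[OF h(2), of c i] by auto
      then have "insert m {x \<in> t. c' x = i} \<in> T i"
        by (rule smooth_tree.extend[OF T[OF i] _ _ c'(2)]) (use h in auto)
      then show ?thesis using colour_class_insert[OF h(4), of ?d i] True d by simp
    next
      case False
      have "{x \<in> t. c' x = i} \<in> T i"
        by (rule smooth_tree.upward[OF T[OF i] _ c'(2)]) (use cls i h(5) in auto)
      then show ?thesis using colour_class_insert[OF h(4), of ?d i] False d by simp
    qed
    moreover have "?d ` insert m t \<subseteq> {..<k}" using c(1) c'(1) by auto
    moreover have "finite (insert m t)" using fin pointwise_le_finite[OF h(3)] by simp
    ultimately show ?thesis using h(5) unfolding tree_merge_def by blast
  qed
qed (auto simp: tree_merge_def)

text \<open>For the lower bound, \<open>less_hsum_listE\<close> names a colour whose summand is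
  lowered, and a new point of that colour realizes the decrease. The claim is proved for every
  admissible colouring of every node, since the colouring grows with the set.\<close>

lemma rk_tree_merge:
  "rk (tree_merge Y k T) {} = hsum_list (map (\<lambda>i. rk (T i) {}) [0..<k])"
proof (rule antisym)
  show "rk (tree_merge Y k T) {} \<le> hsum_list (map (\<lambda>i. rk (T i) {}) [0..<k])"
    by (rule tree_merge_rk_le(2))
  note wf = tree_merge_rk_le(1)
  have "colour_rk c s \<le> rk (tree_merge Y k T) s"
    if "finite s" "s \<subseteq> Y" "c ` s \<subseteq> {..<k}" "\<forall>i<k. {x \<in> s. c x = i} \<in> T i" for c s
    using wf that
  proof (induction s arbitrary: c rule: wf_induct_rule)
    case (less s)
    have s: "s \<in> tree_merge Y k T" using less.prems unfolding tree_merge_def by blast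
    let ?cls = "\<lambda>i. {x \<in> s. c x = i}"
    show ?case
    proof (rule leI, rule notI)
      assume "rk (tree_merge Y k T) s < colour_rk c s"
      then obtain i b where i: "i < k" "b < rk (T i) (?cls i)"
        and le: "rk (tree_merge Y k T) s \<le> hsum_list (map ((\<lambda>i. rk (T i) (?cls i))(i := b)) [0..<k])"
        unfolding colour_rk_def by (rule less_hsum_listE)
      interpret Ti: smooth_tree Y "T i" using i(1) by (rule T)
      obtain n where n: "\<forall>x\<in>?cls i. x < n" "insert n (?cls i) \<in> T i" "b \<le> rk (T i) (insert n (?cls i))"
        using i(2) unfolding less_rk_iff[OF Ti.wf] by blast
      \<comment> \<open>Beyond all of \<open>s\<close>, not only beyond the class of colour
        \<open>i\<close>; by \<open>rk_pointwise_mono\<close> replacing \<open>n\<close> by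
        \<open>m\<close> loses no rank.\<close>
      obtain m where m: "m \<in> Y" "n \<le> m" "\<forall>x\<in>s. x < m"
        using Y less.prems(1) by (rule infinite_nat_above)
      have nm: "insert n (?cls i) \<preceq> insert m (?cls i)" using n(1) m by (intro pointwise_le_insert) auto
      have sub: "insert m (?cls i) \<subseteq> Y" using m(1) less.prems(2) by auto
      have mi: "insert m (?cls i) \<in> T i" using n(2) nm sub by (rule Ti.upward)
      have b: "b \<le> rk (T i) (insert m (?cls i))"
        using n(3) Ti.rk_pointwise_mono[OF n(2) nm sub] by (rule order_trans)
      let ?d = "c(m := i)"
      have d: "{x \<in> insert m s. ?d x = j} = (if i = j then insert m (?cls j) else ?cls j)" for j
        using m(3) by auto
      have good: "finite (insert m s)" "insert m s \<subseteq> Y" "?d ` insert m s \<subseteq> {..<k}"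
        "\<forall>j<k. {x \<in> insert m s. ?d x = j} \<in> T j"
        using less.prems m(1) i(1) mi unfolding d by auto
      then have ms: "insert m s \<in> tree_merge Y k T" unfolding tree_merge_def by blast
      have "hsum_list (map ((\<lambda>i. rk (T i) (?cls i))(i := b)) [0..<k]) \<le> colour_rk ?d (insert m s)"
        unfolding colour_rk_def d by (rule hsum_list_mono) (use b in auto)
      also have "\<dots> \<le> rk (tree_merge Y k T) (insert m s)"
        using s ms m(3) good by (intro less.IH) (auto simp: children_def)
      also have "\<dots> < rk (tree_merge Y k T) s" by (rule rk_insert_less[OF wf s m(3) ms])
      finally show False using le by simp
    qed
  qed
  from this[of "{}"] show "hsum_list (map (\<lambda>i. rk (T i) {}) [0..<k]) \<le> rk (tree_merge Y k T) {}"
    using smooth_tree.root[OF T] by (simp add: colour_rk_def)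
qed

end


section \<open>The Ramsey ordinals of exponent one\<close>

lemma mem_singletons_sum:
  "s \<in> singletons X \<oplus> B \<longleftrightarrow> (\<exists>u\<in>B. \<exists>n\<in>X. (\<forall>x\<in>u. x < n) \<and> s = insert n u)"
  by (auto simp: front_sum_def singletons_def)

lemma root_in_front_tree: "{} \<in> front_tree B"
  by (auto simp: front_tree_def pinit_seg_def init_seg_def)

lemma front_root: "front B \<Longrightarrow> {} \<in> B \<Longrightarrow> B = {{}}"
  using front_no_pinit_seg[of B "{}"] by (auto simp: pinit_seg_def)

lemma smooth_barrier_ht_zero:
  assumes "smooth_barrier B" "ht B = 0"
  shows "B = {{}}"
proof -
  have B: "front B" using assms(1) by (rule smooth_barrier_front)
  then have "rk (front_tree B) {} = 0" using assms(2) ht_eq_rk by simp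
  then have "front_tree B = {{}}"
    by (rule smooth_tree.trivial_if_rk_root[OF smooth_barrier_tree[OF assms(1)]])
  then show ?thesis using leaves_front_tree[OF B] by simp
qed

text \<open>Height 1 leaves no freedom: if \<open>{n}\<close> were not in \<open>C\<close>, it would
  have a child in the tree, and the root would have rank at least 2.\<close>

lemma front_ht_one:
  assumes C: "front C" and ht: "ht C = 1"
  shows "C = singletons (base C)"
proof -
  have one: "(1 :: cord) = osuc 0" by (simp add: one_cord_def)
  have wf: "wf (children (front_tree C))" using wf_tree_child[OF C] by (simp add: tree_child_eq)
  have "0 < ht C" by (simp add: ht one)
  moreover have "ht C = 0" if "{} \<in> C" using ht_at_rec[OF C, of "{}"] that by (simp add: ht_def)
  ultimately have ne: "{} \<notin> C" by auto
  have sing: "{n} \<in> C" if n: "n \<in> base C" for n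
  proof (rule ccontr)
    assume nC: "{n} \<notin> C"
    have T: "{n} \<in> front_tree C"
      using insert_in_front_tree_iff[of "{}" n C] n ne root_in_front_tree by simp
    obtain m where m: "m \<in> base C" "\<forall>x\<in>{n}. x < m"
      using infinite_nat_above[OF front_infinite_base[OF C], of "{n}"] by blast
    have "insert m {n} \<in> front_tree C"
      using insert_in_front_tree_iff[OF m(2), of C] T nC m(1) by simp
    then have "0 < rk (front_tree C) {n}"
      unfolding less_rk_iff[OF wf] using T m(2) by (intro conjI exI[of _ m]) simp_all
    moreover have "rk (front_tree C) {n} < rk (front_tree C) {}"
      using rk_insert_less[OF wf root_in_front_tree, of n] T by simp
    moreover have "rk (front_tree C) {} = osuc 0" using ht_eq_rk[OF C] ht one by simp
    ultimately have "rk (front_tree C) {n} \<le> 0" by (simp only: less_osuc_iff)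
    with \<open>0 < rk (front_tree C) {n}\<close> show False by simp
  qed
  have "s \<in> singletons (base C)" if s: "s \<in> C" for s
  proof -
    have "pinit_seg {} s" using s ne by (auto simp: pinit_seg_def)
    then obtain n where n: "n \<in> s" "init_seg (insert n {}) s" by (rule pinit_seg_next)
    have "n \<in> base C" using n(1) front_subset_base[OF s] by blast
    moreover from this have "s = {n}"
      using front_no_pinit_seg[OF C sing s] n(2) by (auto simp: pinit_seg_def)
    ultimately show ?thesis by (auto simp: singletons_def)
  qed
  then show ?thesis using sing by (auto simp: singletons_def)
qed

lemma base_singletons [simp]: "base (singletons X) = X"
  by (auto simp: base_def singletons_def)

lemma size_subsets_singletons:
  "s \<subseteq> X \<Longrightarrow> size_subsets s (singletons X) = (\<lambda>x. {x}) ` s"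
  by (auto simp: size_subsets_def singletons_def)

text \<open>A counterexample is cut off right after it leaves the tree of \<open>B\<close>. The
  homogeneous set given by the arrow lies inside a colour class, hence in the tree of
  \<open>A i\<close> by \<open>subset_node\<close>, although it properly extends an element of
  \<open>A i\<close>.\<close>

lemma tree_merge_if_arrow:
  assumes A: "\<And>i. i < k \<Longrightarrow> smooth_barrier (A i)"
    and X: "base B \<subseteq> X" and arr: "arrow B A k (singletons X)"
  shows "tree_merge (base B) k (\<lambda>i. front_tree (A i)) \<subseteq> front_tree B"
proof (rule subsetI, rule ccontr)
  fix s assume "s \<in> tree_merge (base B) k (\<lambda>i. front_tree (A i))" and no: "s \<notin> front_tree B"
  then obtain c where s: "finite s" "s \<subseteq> base B" and c: "c ` s \<subseteq> {..<k}"
    "\<forall>i<k. {x \<in> s. c x = i} \<in> front_tree (A i)"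
    unfolding tree_merge_def by blast
  obtain u where u: "u \<in> B" "pinit_seg u s" using s no by (auto simp: front_tree_def)
  obtain n where n: "n \<in> s" "\<forall>x\<in>u. x < n" using u(2) by (rule pinit_seg_next)
  let ?s = "insert n u"
  have us: "?s \<subseteq> s" using u(2) n(1) by (auto simp: pinit_seg_def init_seg_def)
  then have sX: "?s \<subseteq> X" using s(2) X by blast
  have "?s \<in> singletons X \<oplus> B" using u(1) n(2) sX unfolding mem_singletons_sum by blast
  moreover have "(c \<circ> the_elem) ` size_subsets ?s (singletons X) \<subseteq> {..<k}"
    unfolding size_subsets_singletons[OF sX] using order_trans[OF image_mono[OF us] c(1)]
    by (simp add: image_image)
  ultimately obtain i t where it: "i < k" "t \<in> singletons X \<oplus> A i" "t \<subseteq> ?s"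
    "\<forall>v \<in> size_subsets t (singletons X). (c \<circ> the_elem) v = i"
    using arr unfolding arrow_def base_singletons by meson
  have tX: "t \<subseteq> X" using it(3) sX by (rule order_trans)
  have "t \<subseteq> {x \<in> s. c x = i}"
    using it(3,4) us unfolding size_subsets_singletons[OF tX] by auto
  moreover have "{x \<in> s. c x = i} \<in> front_tree (A i)" using c(2) it(1) by blast
  ultimately have "t \<in> front_tree (A i)"
    by (rule smooth_tree.subset_node[OF smooth_barrier_tree[OF A[OF it(1)]], rotated])
  moreover obtain v m where "v \<in> A i" "\<forall>x\<in>v. x < m" "t = insert m v"
    using it(2) unfolding mem_singletons_sum by blast
  ultimately show False using pinit_seg_insert[of v m] unfolding front_tree_def by blast
qed

text \<open>A set that has left the tree of \<open>B\<close> is outside the merged tree, so under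
  any colouring some class leaves the tree of its \<open>A i\<close>; that class, stopped one point
  after an element of \<open>A i\<close>, is the required homogeneous set. \<open>X\<close> and
  \<open>base B\<close> are related only through the elements of \<open>B\<close>, because for
  \<open>k = 0\<close> the degenerate \<open>B\<close> has base \<open>UNIV\<close> while
  \<open>X\<close> is the base of \<open>C\<close>.\<close>

lemma arrow_if_tree_merge:
  assumes Y: "\<And>i. i < k \<Longrightarrow> base B \<subseteq> base (A i)" and B: "front B"
    and X: "\<And>u. u \<in> B \<Longrightarrow> u \<subseteq> X"
    and final: "\<And>u n. u \<in> B \<Longrightarrow> n \<in> X \<Longrightarrow> \<forall>x\<in>u. x < n \<Longrightarrow> n \<in> base B"
    and M: "tree_merge (base B) k (\<lambda>i. front_tree (A i) \<inter> Pow (base B)) \<subseteq> front_tree B"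
  shows "arrow B A k (singletons X)"
  unfolding arrow_def base_singletons
proof (intro ballI allI impI)
  fix s and c :: "nat set \<Rightarrow> nat"
  assume "s \<in> singletons X \<oplus> B" and c: "c ` size_subsets s (singletons X) \<subseteq> {..<k}"
  then obtain u n where s: "u \<in> B" "n \<in> X" "\<forall>x\<in>u. x < n" "s = insert n u"
    unfolding mem_singletons_sum by blast
  have sY: "s \<subseteq> base B" using final[OF s(1-3)] front_subset_base[OF s(1)] s(4) by simp
  have sX: "s \<subseteq> X" using X[OF s(1)] s(2,4) by simp
  have fin: "finite s" using front_finite[OF B s(1)] s(4) by simp
  have cs: "(\<lambda>x. c {x}) ` s \<subseteq> {..<k}"
    using c unfolding size_subsets_singletons[OF sX] by (simp add: image_image)
  have "s \<notin> front_tree B" using s pinit_seg_insert unfolding front_tree_def by blast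
  then have "s \<notin> tree_merge (base B) k (\<lambda>i. front_tree (A i) \<inter> Pow (base B))" using M by blast
  then obtain i where i: "i < k" "{x \<in> s. c {x} = i} \<notin> front_tree (A i) \<inter> Pow (base B)"
    using fin sY cs unfolding tree_merge_def by blast
  let ?w = "{x \<in> s. c {x} = i}"
  have "?w \<subseteq> base B" using sY by blast
  then have "?w \<notin> front_tree (A i)" "?w \<subseteq> base (A i)" using i(2) Y[OF i(1)] by auto
  then obtain v where v: "v \<in> A i" "pinit_seg v ?w" using fin by (auto simp: front_tree_def)
  obtain m where m: "m \<in> ?w" "\<forall>x\<in>v. x < m" using v(2) by (rule pinit_seg_next)
  have t: "insert m v \<subseteq> ?w" using v(2) m(1) by (auto simp: pinit_seg_def init_seg_def)
  then have tX: "insert m v \<subseteq> X" using sX by blast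
  then have "insert m v \<in> singletons X \<oplus> A i" using v(1) m(2) unfolding mem_singletons_sum by blast
  moreover have "\<forall>u\<in>size_subsets (insert m v) (singletons X). c u = i"
    unfolding size_subsets_singletons[OF tX] using t by blast
  moreover have "insert m v \<subseteq> s" using t by blast
  ultimately show "\<exists>i<k. \<exists>t\<in>singletons X \<oplus> A i. t \<subseteq> s \<and> (\<forall>u\<in>size_subsets t (singletons X). c u = i)"
    using i(1) by blast
qed

lemma ram_bound_hsum: "ram_bound k \<alpha> 1 (hsum_list (map \<alpha> [0..<k]))"
  unfolding ram_bound_def
proof (intro allI impI, elim conjE)
  fix A :: "nat \<Rightarrow> nat set set" and C
  let ?\<beta> = "hsum_list (map \<alpha> [0..<k])"
  assume A: "\<forall>i<k. sd_barrier (A i) \<and> ht (A i) = \<alpha> i \<and> final_segment (base (A i)) (base C)"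
    and C: "sd_barrier C" "ht C = 1"
  define Y where "Y = (\<Inter>i<k. base (A i))"
  have fC: "front C" using C(1) by (simp add: sd_barrier_def smooth_barrier_front)
  have CX: "C = singletons (base C)" using fC C(2) by (rule front_ht_one)
  have sb: "smooth_barrier (A i)" if "i < k" for i using A that by (simp add: sd_barrier_def)
  have Y: "infinite Y \<and> (k = 0 \<and> Y = UNIV \<or> (\<exists>M. Y = {n \<in> base C. M \<le> n}))"
  proof (cases "k = 0")
    case False
    have "\<forall>i. \<exists>m. i < k \<longrightarrow> base (A i) = {n \<in> base C. m \<le> n}"
      using A unfolding final_segment_def by blast
    then obtain m where m: "\<And>i. i < k \<Longrightarrow> base (A i) = {n \<in> base C. m i \<le> n}" by metis
    \<comment> \<open>The final segment with the largest starting point is the intersection of all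
      of them.\<close>
    let ?M = "Max (m ` {..<k})"
    have "?M \<in> m ` {..<k}" using False by (intro Max_in) auto
    then obtain j where j: "j < k" "m j = ?M" by auto
    have "m i \<le> m j" if "i < k" for i unfolding j(2) using that by (intro Max_ge) auto
    then have "base (A j) \<subseteq> base (A i)" if "i < k" for i
      using m[OF that] m[OF j(1)] that by fastforce
    then have "Y = base (A j)" using j(1) unfolding Y_def by blast
    then show ?thesis
      using front_infinite_base[OF smooth_barrier_front[OF sb[OF j(1)]]] m[OF j(1)] by metis
  qed (simp add: Y_def)
  \<comment> \<open>Restriction to the common base may lower ranks; the bound by
    \<open>\<alpha> i\<close> survives, and \<open>sd_barrier_majorant\<close> restores the exact
    height.\<close>
  define T where "T i = front_tree (A i) \<inter> Pow Y" for i
  have T: "smooth_tree Y (T i)" "rk (T i) {} \<le> \<alpha> i" if i: "i < k" for i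
  proof -
    have "Y \<subseteq> base (A i)" using i by (auto simp: Y_def)
    note res = smooth_tree_restrict[OF smooth_barrier_tree[OF sb[OF i]] conjunct1[OF Y] this]
    show "smooth_tree Y (T i)" using res(1) by (simp add: T_def)
    show "rk (T i) {} \<le> \<alpha> i"
      using res(2) ht_eq_rk[OF smooth_barrier_front[OF sb[OF i]]] A i by (simp add: T_def)
  qed
  have M: "smooth_tree Y (tree_merge Y k T)" using conjunct1[OF Y] T(1) by (rule smooth_tree_merge)
  have "rk (tree_merge Y k T) {} = hsum_list (map (\<lambda>i. rk (T i) {}) [0..<k])"
    using conjunct1[OF Y] T(1) by (rule rk_tree_merge)
  also have "\<dots> \<le> ?\<beta>" using T(2) by (rule hsum_list_mono)
  finally have rk: "rk (tree_merge Y k T) {} \<le> ?\<beta>" .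
  \<comment> \<open>Sum 0 forces every \<open>A i\<close> to be degenerate, so the common base is
    the one that a barrier of height 0 must have.\<close>
  have UNIV: "Y = UNIV" if zero: "?\<beta> = 0"
  proof -
    have "base (A i) = UNIV" if i: "i < k" for i
    proof -
      have "\<not> 0 < \<alpha> i" using hsum_list_strict_mono[OF i, of 0 \<alpha>] zero by auto
      then have "ht (A i) = 0" using A i by (simp add: not_less antisym)
      then have "A i = {{}}" using sb[OF i] by (rule smooth_barrier_ht_zero[rotated])
      then show ?thesis by (simp add: base_def)
    qed
    then show ?thesis by (simp add: Y_def)
  qed
  obtain B where B: "sd_barrier B" "ht B = ?\<beta>" "base B = Y" "tree_merge Y k T \<subseteq> front_tree B"
    using M rk UNIV by (rule sd_barrier_majorant)
  have sB: "smooth_barrier B" and fB: "front B"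
    using B(1) by (simp_all add: sd_barrier_def smooth_barrier_front)
  have "arrow B A k (singletons (base C))"
  proof (rule arrow_if_tree_merge)
    show "base B \<subseteq> base (A i)" if "i < k" for i using that unfolding B(3) Y_def by blast
    show "u \<subseteq> base C" if u: "u \<in> B" for u
    proof (cases "k = 0")
      case True
      then have "ht B = 0" by (simp add: B(2) hsum_list_def)
      then have "B = {{}}" using sB by (rule smooth_barrier_ht_zero[rotated])
      then show ?thesis using u by simp
    next
      case False
      then show ?thesis using Y front_subset_base[OF u] unfolding B(3) by blast
    qed
    show "n \<in> base B" if u: "u \<in> B" "n \<in> base C" "\<forall>x\<in>u. x < n" for u n
    proof (cases "u = {}")
      case True
      then have "B = {{}}" using front_root[OF fB] u(1) by blast
      then show ?thesis by (simp add: base_def)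
    next
      case False
      then obtain x where "x \<in> u" by blast
      then have "x \<in> Y" "x \<le> n" using front_subset_base[OF u(1)] u(3) unfolding B(3) by auto
      then show ?thesis using Y u(2) unfolding B(3) by (metis (no_types, lifting) UNIV_I mem_Collect_eq order_trans)
    qed
    show "tree_merge (base B) k (\<lambda>i. front_tree (A i) \<inter> Pow (base B)) \<subseteq> front_tree B"
      using B(4) unfolding B(3) T_def .
  qed (rule fB)
  then have "arrow B A k C" using CX by simp
  then show "\<exists>B. sd_barrier B \<and> ht B = ?\<beta> \<and> base B = (\<Inter>i<k. base (A i)) \<and> arrow B A k C"
    using B(1-3) unfolding Y_def by blast
qed

text \<open>One instance suffices: barriers of the prescribed heights on the base
  \<open>UNIV\<close>, where no restriction can lower the ranks of the trees.\<close>

lemma ram_bound_ge: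
  assumes "ram_bound k \<alpha> 1 \<beta>"
  shows "hsum_list (map \<alpha> [0..<k]) \<le> \<beta>"
proof -
  have "\<forall>i. \<exists>B. sd_barrier B \<and> ht B = \<alpha> i \<and> base B = UNIV" by (metis sd_barrier_exists)
  then obtain A where A: "\<And>i. sd_barrier (A i)" "\<And>i. ht (A i) = \<alpha> i" "\<And>i. base (A i) = UNIV" by metis
  obtain C where C: "sd_barrier C" "ht C = 1" "base C = UNIV" by (rule sd_barrier_exists)
  have "final_segment UNIV UNIV" unfolding final_segment_def by (intro exI[of _ 0]) simp
  then obtain B where B: "sd_barrier B" "ht B = \<beta>" "base B = UNIV" "arrow B A k C"
    using assms[unfolded ram_bound_def, THEN spec[of _ A], THEN spec[of _ C]] A C by auto
  have sb: "smooth_barrier (A i)" for i using A by (simp add: sd_barrier_def)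
  have fB: "front B" and fC: "front C" using B(1) C(1) by (simp_all add: sd_barrier_def smooth_barrier_front)
  have T: "smooth_tree UNIV (front_tree (A i))" for i using smooth_barrier_tree[OF sb] A(3) by metis
  have "arrow B A k (singletons UNIV)" using B(4) front_ht_one[OF fC C(2)] C(3) by simp
  then have "tree_merge UNIV k (\<lambda>i. front_tree (A i)) \<subseteq> front_tree B"
    using tree_merge_if_arrow[of k A B UNIV] sb B(3) by simp
  then have "rk (tree_merge UNIV k (\<lambda>i. front_tree (A i))) {} \<le> rk (front_tree B) {}"
    using smooth_tree.rk_mono[OF smooth_tree_merge[OF infinite_UNIV_nat T]]
      smooth_tree.root[OF smooth_tree_merge[OF infinite_UNIV_nat T]]
      wf_tree_child[OF fB] by (simp add: tree_child_eq)
  also have "\<dots> = \<beta>" using ht_eq_rk[OF fB] B(2) by simp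
  also have "rk (tree_merge UNIV k (\<lambda>i. front_tree (A i))) {} = hsum_list (map \<alpha> [0..<k])"
    using ht_eq_rk[OF smooth_barrier_front[OF sb]] A(2)
    by (subst rk_tree_merge[OF infinite_UNIV_nat T]) (intro arg_cong[where f = hsum_list] map_cong, simp_all)
  finally show ?thesis .
qed

text \<open>The first conjunct ensures that the \<open>LEAST\<close> in \<open>Ram\<close> is taken
  over a nonempty set of ordinals.\<close>

theorem theorem5p5:
  fixes k :: nat and \<alpha> :: "nat \<Rightarrow> cord"
  shows "(\<exists>\<beta>. ram_bound k \<alpha> 1 \<beta>) \<and> Ram k \<alpha> 1 = hsum_list (map \<alpha> [0..<k])"
  unfolding Ram_def using ram_bound_hsum ram_bound_ge by (blast intro: Least_equality)

end
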